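(* Let $Z_0,Z\in\mathcal B(\mathcal H)$ and assume that $Z-Z_0\in\mathcal S_p(\mathcal H)$ for some $p\ge1$. Moreover, let $Z_0$ be normal and assume that $\sigma(Z_0)$ is convex. Then $$\sum_{\lambda\in\sigma_d(Z)}\operatorname{dist}(\lambda,\sigma(Z_0))^p\le\|Z-Z_0\|_{\mathcal S_p}^p .$$
   Context: $\mathcal H$ is a complex separable Hilbert space, $\mathcal B(\mathcal H)$ the bounded operators on $\mathcal H$. $\mathcal S_p(\mathcal H)$ is the Schatten class of order $p$, with norm $\|K\|_{\mathcal S_p}=(\sum_ns_n(K)^p)^{1/p}$, $s_n(K)$ being the singular values. A discrete eigenvalue of a closed operator $Z$ is an isolated point $\lambda$ of $\sigma(Z)$ such that the Riesz projection $P_Z(\lambda)=\frac1{2\pi i}\oint(\mu-Z)^{-1}d\mu$ (over a small counterclockwise circle around $\lambda$) has finite rank; this rank is the algebraic multiplicity. $\sigma_d(Z)$ is the set of discrete eigenvalues. In sums over $\sigma_d(Z)$ each eigenvalue is counted according to its algebraic multiplicity. *)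

theory Defs
  imports "HOL-Complex_Analysis.Complex_Analysis"
begin

section \<open>Complex Hilbert spaces\<close>

text \<open>
  A complex inner product space is a real inner product space (which provides the norm and the
  topology) with a compatible complex scalar multiplication and a complex inner product, linear
  in the first argument, whose real part is the real inner product.
\<close>

class complex_inner = real_inner +
  fixes scaleC :: "complex \<Rightarrow> 'a \<Rightarrow> 'a" (infixr \<open>*\<^sub>C\<close> 75)
    and cinner :: "'a \<Rightarrow> 'a \<Rightarrow> complex"
  assumes scaleC_add_right: "c *\<^sub>C (x + y) = c *\<^sub>C x + c *\<^sub>C y"
    and scaleC_add_left: "(c + d) *\<^sub>C x = c *\<^sub>C x + d *\<^sub>C x"
    and scaleC_scaleC: "c *\<^sub>C d *\<^sub>C x = (c * d) *\<^sub>C x"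
    and scaleC_of_real: "complex_of_real r *\<^sub>C x = r *\<^sub>R x"
    and cinner_commute: "cinner x y = cnj (cinner y x)"
    and cinner_add_left: "cinner (x + y) z = cinner x z + cinner y z"
    and cinner_scaleC_left: "cinner (c *\<^sub>C x) y = c * cinner x y"
    and Re_cinner: "Re (cinner x y) = x \<bullet> y"

class complex_hilbert = complex_inner + banach

lemma scaleC_one: "1 *\<^sub>C x = (x :: 'a :: complex_inner)"
  using scaleC_of_real[of 1 x] by simp

global_interpretation complex_vector: vector_space "scaleC :: complex \<Rightarrow> 'a \<Rightarrow> 'a :: complex_inner"
  by unfold_locales (simp_all add: scaleC_add_right scaleC_add_left scaleC_scaleC scaleC_one)

lemma cinner_self: "cinner x x = complex_of_real ((norm (x :: 'a :: complex_inner))\<^sup>2)"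
proof (rule complex_eqI)
  show "Im (cinner x x) = Im (complex_of_real ((norm x)\<^sup>2))"
    using arg_cong[OF cinner_commute[of x x], of Im] by simp
qed (simp add: Re_cinner dot_square_norm)

lemma norm_scaleC: "norm (c *\<^sub>C x) = cmod c * norm (x :: 'a :: complex_inner)"
proof -
  have "cinner (c *\<^sub>C x) (c *\<^sub>C x) = c * cnj c * cinner x x"
    by (metis cinner_commute cinner_scaleC_left complex_cnj_mult mult.assoc)
  then have "complex_of_real ((norm (c *\<^sub>C x))\<^sup>2) = complex_of_real ((cmod c * norm x)\<^sup>2)"
    by (simp only: cinner_self of_real_mult power_mult_distrib complex_norm_square[of c])
  then have "(norm (c *\<^sub>C x))\<^sup>2 = (cmod c * norm x)\<^sup>2"
    by (simp only: of_real_eq_iff)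
  then show ?thesis
    by (simp add: power2_eq_iff_nonneg)
qed

section \<open>Bounded operators\<close>

text \<open>
  Elements of the type \<open>'a \<Rightarrow>\<^sub>L 'a\<close> are only real-linear; the complex-linear ones form the
  algebra of bounded operators on the complex Hilbert space \<open>'a\<close>, with the operator norm.
\<close>

definition bounded_operators :: "('a :: complex_hilbert \<Rightarrow>\<^sub>L 'a) set" where
  "bounded_operators = {A. \<forall>c x. blinfun_apply A (c *\<^sub>C x) = c *\<^sub>C blinfun_apply A x}"

text \<open>
  \<open>scalar_op c\<close> is \<open>c\<close> times the identity, so that \<open>scalar_op c o\<^sub>L A\<close> is the complex multiple
  \<open>c A\<close> of an operator \<open>A\<close>.
\<close>

lift_definition scalar_op :: "complex \<Rightarrow> 'a :: complex_hilbert \<Rightarrow>\<^sub>L 'a" is scaleC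
proof -
  fix c :: complex
  show "bounded_linear (scaleC c :: 'a \<Rightarrow> 'a)"
  proof (rule bounded_linear_intro[where K = "cmod c"])
    fix r :: real and x :: 'a
    show "c *\<^sub>C r *\<^sub>R x = r *\<^sub>R c *\<^sub>C x"
      by (metis mult.commute scaleC_of_real scaleC_scaleC)
  qed (simp_all add: scaleC_add_right norm_scaleC mult.commute)
qed

definition adjoint_op :: "('a :: complex_hilbert \<Rightarrow>\<^sub>L 'a) \<Rightarrow> ('a \<Rightarrow>\<^sub>L 'a)" where
  "adjoint_op A =
     (THE B. \<forall>x y. cinner (blinfun_apply A x) y = cinner x (blinfun_apply B y))"

definition normal_op :: "('a :: complex_hilbert \<Rightarrow>\<^sub>L 'a) \<Rightarrow> bool" where
  "normal_op A \<longleftrightarrow> adjoint_op A o\<^sub>L A = A o\<^sub>L adjoint_op A"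

definition is_inverse_op :: "('a :: complex_hilbert \<Rightarrow>\<^sub>L 'a) \<Rightarrow> ('a \<Rightarrow>\<^sub>L 'a) \<Rightarrow> bool" where
  "is_inverse_op A B \<longleftrightarrow>
     B \<in> bounded_operators \<and> A o\<^sub>L B = id_blinfun \<and> B o\<^sub>L A = id_blinfun"

definition spectrum :: "('a :: complex_hilbert \<Rightarrow>\<^sub>L 'a) \<Rightarrow> complex set" where
  "spectrum A = {\<mu>. \<not> (\<exists>B. is_inverse_op (scalar_op \<mu> - A) B)}"

definition resolvent :: "('a :: complex_hilbert \<Rightarrow>\<^sub>L 'a) \<Rightarrow> complex \<Rightarrow> ('a \<Rightarrow>\<^sub>L 'a)" where
  "resolvent A \<mu> = (THE B. is_inverse_op (scalar_op \<mu> - A) B)"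

definition finite_rank :: "('a :: complex_hilbert \<Rightarrow>\<^sub>L 'a) \<Rightarrow> bool" where
  "finite_rank A \<longleftrightarrow> (\<exists>S. finite S \<and> range (blinfun_apply A) \<subseteq> complex_vector.span S)"

definition op_rank :: "('a :: complex_hilbert \<Rightarrow>\<^sub>L 'a) \<Rightarrow> nat" where
  "op_rank A = complex_vector.dim (range (blinfun_apply A))"

section \<open>Discrete eigenvalues\<close>

text \<open>The operator-valued analogue of \<^const>\<open>contour_integral\<close>, as an integral in the operator norm.\<close>

definition op_contour_integral ::
    "(real \<Rightarrow> complex) \<Rightarrow> (complex \<Rightarrow> ('a :: complex_hilbert \<Rightarrow>\<^sub>L 'a)) \<Rightarrow> ('a \<Rightarrow>\<^sub>L 'a)" where
  "op_contour_integral g F =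
     integral {0..1}
       (\<lambda>t. scalar_op (vector_derivative g (at t within {0..1})) o\<^sub>L F (g t))"

text \<open>
  For an isolated point of the spectrum, the integral does not depend on the radius of the
  circle as long as the closed disc contains no other point of the spectrum. The definition
  is only meaningful for such points.
\<close>

definition riesz_projection ::
    "('a :: complex_hilbert \<Rightarrow>\<^sub>L 'a) \<Rightarrow> complex \<Rightarrow> ('a \<Rightarrow>\<^sub>L 'a)" where
  "riesz_projection A z =
     (let r = (SOME r. r > 0 \<and> cball z r \<inter> spectrum A = {z})
      in scalar_op (1 / (2 * of_real pi * \<i>)) o\<^sub>L
           op_contour_integral (circlepath z r) (resolvent A))"

definition discrete_spectrum :: "('a :: complex_hilbert \<Rightarrow>\<^sub>L 'a) \<Rightarrow> complex set" where
  "discrete_spectrum A =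
     {z. z isolated_in spectrum A \<and> finite_rank (riesz_projection A z)}"

definition alg_multiplicity :: "('a :: complex_hilbert \<Rightarrow>\<^sub>L 'a) \<Rightarrow> complex \<Rightarrow> nat" where
  "alg_multiplicity A z = op_rank (riesz_projection A z)"

section \<open>Schatten classes\<close>

definition compact_op :: "('a :: complex_hilbert \<Rightarrow>\<^sub>L 'a) \<Rightarrow> bool" where
  "compact_op K \<longleftrightarrow> compact (closure (blinfun_apply K ` cball 0 1))"

text \<open>
  For a compact operator \<open>K\<close>, the singular values are the eigenvalues of \<open>|K|\<close>, that is, the
  square roots of the eigenvalues of \<open>K\<^sup>*K\<close>, in nonincreasing order and repeated according to
  multiplicity. If there are only finitely many nonzero ones, the sequence is continued by zeros.
  For compact \<open>K\<close> these conditions determine the sequence (indexed from 0); the definition is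
  not meaningful for other \<open>K\<close>.
\<close>

definition singular_value :: "('a :: complex_hilbert \<Rightarrow>\<^sub>L 'a) \<Rightarrow> nat \<Rightarrow> real" where
  "singular_value K =
     (THE s. decseq s \<and> (\<forall>n. s n \<ge> 0) \<and>
       (\<forall>t>0. finite {n. s n = t} \<and>
          card {n. s n = t} =
            complex_vector.dim
              {x. blinfun_apply (adjoint_op K o\<^sub>L K) x = complex_of_real (t\<^sup>2) *\<^sub>C x}))"

definition schatten_class :: "real \<Rightarrow> ('a :: complex_hilbert \<Rightarrow>\<^sub>L 'a) set" where
  "schatten_class p =
     {K \<in> bounded_operators. compact_op K \<and> summable (\<lambda>n. singular_value K n powr p)}"

definition schatten_norm :: "real \<Rightarrow> ('a :: complex_hilbert \<Rightarrow>\<^sub>L 'a) \<Rightarrow> real" where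
  "schatten_norm p K = (\<Sum>n. singular_value K n powr p) powr (1 / p)"

end

theory Submission
  imports Defs "HOL-Computational_Algebra.Fundamental_Theorem_Algebra"
begin

text \<open>
  The numbers \<open>\<lambda> - \<langle>Z\<^sub>0 e, e\<rangle>\<close> are diagonal matrix elements of \<open>Z - Z\<^sub>0\<close> as soon as \<open>e\<close> is a unit
  vector with \<open>\<langle>Z e, e\<rangle> = \<lambda>\<close>, and the diagonal of an operator in an orthonormal system is
  dominated in \<open>\<ell>\<^sup>p\<close> by its singular values. Hence the estimate follows from three facts.

  First, for any finite set of discrete eigenvalues there is an orthonormal system in which \<open>Z\<close> is
  triangular and whose diagonal carries each of these eigenvalues with its algebraic multiplicity
  (\<open>ex_schur_chain\<close>, \<open>discrete_eigenspace\<close>). It is a Schur basis of the sum of the ranges of the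
  Riesz projections. Such a range is invariant and finite-dimensional, and \<open>Z - \<lambda>\<close> is nilpotent on
  it, because the projection is idempotent and kills every eigenvector for another eigenvalue.

  Second, \<open>\<langle>Z\<^sub>0 e, e\<rangle>\<close> lies in the spectrum of \<open>Z\<^sub>0\<close>, so its distance from \<open>\<lambda>\<close> is at least
  \<open>dist(\<lambda>, \<sigma>(Z\<^sub>0))\<close> (\<open>numerical_value_in_convex_spectrum\<close>). Otherwise a large disc would separate
  this value from the closed convex spectrum, in contradiction to the resolvent estimate
  \<open>\<parallel>(\<mu> - Z\<^sub>0) x\<parallel> \<ge> d \<parallel>x\<parallel>\<close> for normal operators and discs of radius \<open>d\<close> about \<open>\<mu>\<close> that avoid the
  spectrum (\<open>normal_op_lower_bound\<close>).

  Third, \<open>\<Sum>\<^sub>i |\<langle>K e\<^sub>i, e\<^sub>i\<rangle>|\<^sup>p \<le> \<Sum>\<^sub>n s\<^sub>n(K)\<^sup>p\<close> for orthonormal \<open>e\<^sub>i\<close> (\<open>sum_diagonal_powr_le\<close>): in the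
  singular value expansion of \<open>K\<close> the diagonal is \<open>s\<close> multiplied by a doubly substochastic matrix,
  and Jensen's inequality applies.

  Complex analysis is applied to scalar functions only, namely to the matrix elements
  \<open>\<mu> \<mapsto> \<langle>(\<mu> - A)\<^sup>-\<^sup>1 x, y\<rangle>\<close> of resolvents, which are holomorphic outside the spectrum.
\<close>

section \<open>Inner products and adjoints\<close>

lemma cinner_add_right: "cinner x (y + z) = cinner x y + cinner x (z :: 'a :: complex_inner)"
  by (metis cinner_add_left cinner_commute complex_cnj_add)

lemma cinner_scaleC_right: "cinner x (c *\<^sub>C y) = cnj c * cinner x (y :: 'a :: complex_inner)"
  by (metis cinner_commute cinner_scaleC_left complex_cnj_mult)

text \<open>
  A unimodular factor turns the complex inner product into a nonnegative real one, to which the real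
  Cauchy-Schwarz inequality applies.
\<close>
lemma cmod_cinner_le: "cmod (cinner x y) \<le> norm x * norm (y :: 'a :: complex_inner)"
proof (cases "cinner x y = 0")
  case False
  define c where "c = cnj (sgn (cinner x y))"
  have c: "cmod c = 1"
    using False by (simp add: c_def norm_sgn)
  have "cinner (c *\<^sub>C x) y = cmod (cinner x y)"
    using False unfolding c_def cinner_scaleC_left sgn_eq complex_cnj_divide
    by (simp add: complex_norm_square[symmetric] power2_eq_square mult.commute[of "cnj _"])
  then have "cmod (cinner x y) = Re (cinner (c *\<^sub>C x) y)"
    by simp
  also have "\<dots> \<le> norm (c *\<^sub>C x) * norm y"
    unfolding Re_cinner by (rule norm_cauchy_schwarz)
  finally show ?thesis
    by (simp add: norm_scaleC c)
qed simp

lemma bounded_bilinear_cinner: "bounded_bilinear (cinner :: 'a :: complex_inner \<Rightarrow> 'a \<Rightarrow> complex)"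
proof
  show "\<exists>K. \<forall>a b :: 'a. norm (cinner a b) \<le> norm a * norm b * K"
    using cmod_cinner_le by (metis mult.right_neutral)
qed (simp_all add: cinner_add_left cinner_add_right cinner_scaleC_left cinner_scaleC_right
      scaleR_conv_of_real flip: scaleC_of_real)

interpretation cinner: bounded_bilinear "cinner :: 'a :: complex_inner \<Rightarrow> 'a \<Rightarrow> complex"
  by (rule bounded_bilinear_cinner)

lemmas cinner_simps = cinner.add_left cinner.add_right cinner.diff_left cinner.diff_right
  cinner.minus_left cinner.minus_right cinner_scaleC_left cinner_scaleC_right

lemma cinner_eq_zero_iff: "cinner x x = 0 \<longleftrightarrow> x = (0 :: 'a :: complex_inner)"
  by (simp add: cinner_self)

lemma cinner_zero_sym: "cinner x y = 0 \<longleftrightarrow> cinner y x = (0 :: complex)"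
  by (metis cinner_commute complex_cnj_zero_iff)

lemma cinner_ext_left:
  assumes "\<And>z. cinner x z = cinner y z"
  shows "x = (y :: 'a :: complex_inner)"
  using assms[of "x - y"] cinner_eq_zero_iff[of "x - y"] by (simp add: cinner.diff_left)

lemma norm_add_square: "(norm (x + y))\<^sup>2 = (norm x)\<^sup>2 + 2 * Re (cinner x y) + (norm y)\<^sup>2"
  by (simp add: Re_cinner power2_norm_eq_inner inner_add inner_commute)

lemma norm_diff_square: "(norm (x - y))\<^sup>2 = (norm x)\<^sup>2 - 2 * Re (cinner x y) + (norm y)\<^sup>2"
  by (simp add: Re_cinner power2_norm_eq_inner inner_diff inner_commute)

lemma norm_le_of_cmod_cinner_le:
  assumes "\<And>y. cmod (cinner x y) \<le> b * norm y" "0 \<le> b"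
  shows "norm (x :: 'a :: complex_inner) \<le> b"
proof (cases "x = 0")
  case False
  have "(norm x) * norm x \<le> b * norm x"
    using assms(1)[of x] by (simp add: cinner_self power2_eq_square norm_mult)
  then show ?thesis using False by simp
qed (use assms in simp)

text \<open>
  The representing vector is the minimizer of \<open>q y = \<parallel>y\<parallel>\<^sup>2 - 2 f y\<close>: minimizing sequences are Cauchy
  by the parallelogram law, and the derivative of \<open>q\<close> vanishes at the minimum.
\<close>
lemma riesz_representation:
  fixes f :: "'a :: {real_inner, banach} \<Rightarrow> real"
  assumes "bounded_linear f"
  shows "\<exists>y. \<forall>x. f x = x \<bullet> y"
proof -
  interpret f: bounded_linear f by fact
  define q where "q y = (norm y)\<^sup>2 - 2 * f y" for y
  obtain B where B: "0 \<le> B" "\<And>x. \<bar>f x\<bar> \<le> norm x * B"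
    using f.nonneg_bounded by auto
  have q_lower: "- B\<^sup>2 \<le> q y" for y
  proof -
    have "q y \<ge> (norm y)\<^sup>2 - 2 * (norm y * B)"
      using B(2)[of y] by (simp add: q_def)
    moreover have "0 \<le> (norm y - B)\<^sup>2" by simp
    ultimately show ?thesis by (simp add: power2_diff)
  qed
  define m where "m = (INF y. q y)"
  have bdd: "bdd_below (range q)"
    using q_lower by (intro bdd_belowI2) auto
  have m_le: "m \<le> q y" for y
    unfolding m_def by (rule cINF_lower[OF bdd]) simp
  have ex_less: "\<exists>y. q y < a" if "m < a" for a
    using that cINF_less_iff[OF UNIV_not_empty bdd] by (simp add: m_def)
  have "\<exists>y. q y < m + 1 / (real n + 1)" for n
    by (rule ex_less) simp
  then obtain Y where Y: "\<And>n. q (Y n) < m + 1 / (real n + 1)"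
    by metis
  have par: "(norm (x - y))\<^sup>2 \<le> 2 * (q x - m) + 2 * (q y - m)" for x y
  proof -
    have "(norm (x - y))\<^sup>2 = 2 * q x + 2 * q y - 4 * q ((1/2) *\<^sub>R (x + y))"
      by (simp add: q_def f.scaleR f.add power2_norm_eq_inner inner_add inner_diff inner_commute
          algebra_simps)
    then show ?thesis using m_le[of "(1/2) *\<^sub>R (x + y)"] by simp
  qed
  have "Cauchy Y"
  proof (rule CauchyI)
    fix e :: real assume "0 < e"
    then obtain M :: nat where M: "4 / e\<^sup>2 < real M"
      using reals_Archimedean2 by blast
    have "norm (Y i - Y j) < e" if "M \<le> i" "M \<le> j" for i j
    proof -
      have "1 / (real i + 1) \<le> 1 / (real M + 1)" "1 / (real j + 1) \<le> 1 / (real M + 1)"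
        using that by (auto intro!: divide_left_mono)
      then have "(norm (Y i - Y j))\<^sup>2 < 4 * (1 / (real M + 1))"
        using par[of "Y i" "Y j"] Y[of i] Y[of j] by argo
      also have "\<dots> < e\<^sup>2"
      proof -
        have "4 < real M * e\<^sup>2" using M \<open>0 < e\<close> by (simp add: field_simps)
        then show ?thesis using \<open>0 < e\<close> by (simp add: field_simps add_strict_increasing)
      qed
      finally show ?thesis using \<open>0 < e\<close> by (simp add: power2_less_imp_less)
    qed
    then show "\<exists>M. \<forall>i\<ge>M. \<forall>j\<ge>M. norm (Y i - Y j) < e" by blast
  qed
  then obtain y where y: "Y \<longlonglongrightarrow> y"
    using Cauchy_convergent_iff convergent_def by blast
  have "(\<lambda>n. q (Y n)) \<longlonglongrightarrow> q y"
    unfolding q_def by (intro tendsto_intros f.tendsto y)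
  moreover have "(\<lambda>n. 1 / (real n + 1)) \<longlonglongrightarrow> 0"
    using LIMSEQ_inverse_real_of_nat by (simp add: inverse_eq_divide add.commute)
  then have "(\<lambda>n. m + 1 / (real n + 1)) \<longlonglongrightarrow> m + 0"
    by (intro tendsto_intros)
  ultimately have "q y \<le> m + 0"
    using Y by (intro LIMSEQ_le) (auto intro: less_imp_le)
  then have min: "q y \<le> q z" for z
    using m_le[of z] by simp
  have "f x = x \<bullet> y" for x
  proof (rule ccontr)
    define a where "a = f x - x \<bullet> y"
    assume "f x \<noteq> x \<bullet> y"
    then have a: "a \<noteq> 0" by (simp add: a_def)
    have x0: "x \<noteq> 0" using a by (auto simp: a_def f.zero)
    define t where "t = a / (norm x)\<^sup>2"
    have "q (y + t *\<^sub>R x) = q y - 2 * t * a + t\<^sup>2 * (norm x)\<^sup>2"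
      unfolding q_def a_def power2_norm_eq_inner
      by (simp add: f.scaleR f.add inner_add inner_commute[of x y] algebra_simps power2_eq_square)
    also have "\<dots> = q y - a\<^sup>2 / (norm x)\<^sup>2"
      using x0 by (simp add: t_def power2_eq_square field_simps)
    also have "\<dots> < q y" using a x0 by simp
    finally show False using min[of "y + t *\<^sub>R x"] by simp
  qed
  then show ?thesis by blast
qed

lemma in_bounded_operators: "A \<in> bounded_operators \<longleftrightarrow> (\<forall>c x. A (c *\<^sub>C x) = c *\<^sub>C A x)"
  by (simp add: bounded_operators_def)

lemma bounded_operators_scaleC: "A \<in> bounded_operators \<Longrightarrow> A (c *\<^sub>C x) = c *\<^sub>C A x"
  by (simp add: bounded_operators_def)

lemma scalar_op_apply [simp]: "scalar_op c x = c *\<^sub>C x"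
  by (simp add: scalar_op.rep_eq)

text \<open>
  Representing the real functional \<open>x \<mapsto> Re \<langle>A x, y\<rangle>\<close> suffices, since a complex-linear functional is
  determined by its real part.
\<close>
lemma ex_adjoint:
  fixes A :: "'a :: complex_hilbert \<Rightarrow>\<^sub>L 'a"
  assumes A: "A \<in> bounded_operators"
  shows "\<exists>B \<in> bounded_operators. \<forall>x y. cinner (A x) y = cinner x (B y)"
proof -
  have "\<exists>z. \<forall>x. cinner (A x) y = cinner x z" for y
  proof -
    have "bounded_linear (\<lambda>x. A x \<bullet> y)"
      using bounded_linear_compose[OF bounded_linear_inner_left blinfun.bounded_linear_right] .
    from riesz_representation[OF this] obtain z where z: "\<And>x. A x \<bullet> y = x \<bullet> z" by blast
    have re: "Re (cinner (A x) y) = Re (cinner x z)" for x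
      by (simp add: Re_cinner z)
    have "Im (cinner (A x) y) = Im (cinner x z)" for x
      using re[of "\<i> *\<^sub>C x"] by (simp add: bounded_operators_scaleC[OF A] cinner_scaleC_left)
    with re show ?thesis by (auto intro!: exI[of _ z] complex_eqI)
  qed
  then obtain b where b: "\<And>x y. cinner (A x) y = cinner x (b y)"
    by metis
  have ext: "u = v" if "\<And>x. cinner x u = cinner x v" for u v :: 'a
    using that by (metis cinner_commute cinner_ext_left)
  have add: "b (u + v) = b u + b v" for u v
    by (rule ext) (simp flip: b add: cinner_simps)
  have scale: "b (c *\<^sub>C u) = c *\<^sub>C b u" for c u
    by (rule ext) (simp flip: b add: cinner_simps)
  have bd: "norm (b u) \<le> norm u * norm A" for u
  proof (rule norm_le_of_cmod_cinner_le)
    fix y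
    have "cmod (cinner (b u) y) = cmod (cinner (A y) u)"
      by (metis b cinner_commute complex_mod_cnj)
    also have "\<dots> \<le> norm (A y) * norm u" by (rule cmod_cinner_le)
    also have "\<dots> \<le> norm A * norm y * norm u"
      by (intro mult_right_mono norm_blinfun) simp
    finally show "cmod (cinner (b u) y) \<le> norm u * norm A * norm y"
      by (simp add: mult_ac)
  qed simp
  have "bounded_linear b"
    by (rule bounded_linear_intro[OF add _ bd]) (simp add: scale flip: scaleC_of_real)
  then have "blinfun_apply (Blinfun b) = b" by (rule bounded_linear_Blinfun_apply)
  then show ?thesis
    using b scale by (intro bexI[of _ "Blinfun b"]) (simp_all add: in_bounded_operators)
qed

lemma adjoint_op:
  assumes "A \<in> bounded_operators"
  shows adjoint_op_bounded_operators: "adjoint_op A \<in> bounded_operators"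
    and cinner_adjoint: "cinner (A x) y = cinner x (adjoint_op A y)"
proof -
  obtain B where B: "B \<in> bounded_operators" "\<forall>x y. cinner (A x) y = cinner x (B y)"
    using ex_adjoint[OF assms] by blast
  have "adjoint_op A = B"
    unfolding adjoint_op_def
  proof (rule the_equality)
    fix C :: "'a \<Rightarrow>\<^sub>L 'a" assume "\<forall>x y. cinner (A x) y = cinner x (C y)"
    then show "C = B"
      using B(2) by (intro blinfun_eqI) (metis cinner_commute cinner_ext_left)
  qed (rule B)
  with B show "adjoint_op A \<in> bounded_operators" "cinner (A x) y = cinner x (adjoint_op A y)"
    by simp_all
qed

lemma cinner_adjoint':
  "A \<in> bounded_operators \<Longrightarrow> cinner (adjoint_op A x) y = cinner x (A y)"
  by (metis cinner_adjoint cinner_commute)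

section \<open>Singular values of compact operators\<close>

text \<open>
  Bessel's inequality. Vectors of norm less than 1 are admitted because the singular systems below are
  continued by zero vectors.
\<close>
lemma bessel_finite:
  fixes v :: "'i \<Rightarrow> 'a :: complex_inner"
  assumes fin: "finite I"
    and orth: "\<And>i j. i \<in> I \<Longrightarrow> j \<in> I \<Longrightarrow> i \<noteq> j \<Longrightarrow> cinner (v i) (v j) = 0"
    and le1: "\<And>i. i \<in> I \<Longrightarrow> norm (v i) \<le> 1"
  shows "(\<Sum>i\<in>I. (cmod (cinner x (v i)))\<^sup>2) \<le> (norm x)\<^sup>2"
proof -
  define c where "c i = cinner x (v i)" for i
  define y where "y = (\<Sum>i\<in>I. c i *\<^sub>C v i)"
  have "cinner x y = (\<Sum>i\<in>I. cnj (c i) * c i)"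
    by (simp add: y_def cinner.sum_right cinner_scaleC_right c_def)
  then have xy: "cinner x y = complex_of_real (\<Sum>i\<in>I. (cmod (c i))\<^sup>2)"
    by (simp only: of_real_sum complex_norm_square mult.commute)
  have yl: "cinner y w = (\<Sum>i\<in>I. c i * cinner (v i) w)" for w
    by (simp add: y_def cinner.sum_left cinner_scaleC_left)
  have yr: "cinner w y = (\<Sum>j\<in>I. cnj (c j) * cinner w (v j))" for w
    by (simp add: y_def cinner.sum_right cinner_scaleC_right)
  have "cinner y y = (\<Sum>i\<in>I. c i * (\<Sum>j\<in>I. cnj (c j) * cinner (v i) (v j)))"
    unfolding yl[of y] by (simp only: yr)
  also have "\<dots> = (\<Sum>i\<in>I. \<Sum>j\<in>I. c i * cnj (c j) * cinner (v i) (v j))"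
    by (simp add: sum_distrib_left mult.assoc)
  also have "\<dots> = (\<Sum>i\<in>I. \<Sum>j\<in>I. if i = j then c i * cnj (c i) * cinner (v i) (v i) else 0)"
    by (intro sum.cong) (auto simp: orth)
  also have "\<dots> = (\<Sum>i\<in>I. c i * cnj (c i) * cinner (v i) (v i))"
    using fin by simp
  also have "\<dots> = complex_of_real (\<Sum>i\<in>I. (cmod (c i))\<^sup>2 * (norm (v i))\<^sup>2)"
    by (simp only: of_real_sum of_real_mult complex_norm_square[of "c _"] cinner_self)
  finally have "(norm y)\<^sup>2 = (\<Sum>i\<in>I. (cmod (c i))\<^sup>2 * (norm (v i))\<^sup>2)"
    unfolding cinner_self by (simp only: of_real_eq_iff)
  also have "\<dots> \<le> (\<Sum>i\<in>I. (cmod (c i))\<^sup>2)"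
    using le1 by (intro sum_mono) (simp add: mult_left_le power_le_one)
  finally have "(norm y)\<^sup>2 \<le> (\<Sum>i\<in>I. (cmod (c i))\<^sup>2)" .
  moreover have "0 \<le> (norm (x - y))\<^sup>2" by simp
  ultimately show ?thesis
    by (simp add: norm_diff_square xy flip: c_def)
qed

text \<open>
  Only the first \<open>n\<close> vectors of the sequence enter, so that a sequence of singular vectors can be
  chosen recursively.
\<close>
definition orthogonal_to :: "nat \<Rightarrow> (nat \<Rightarrow> 'a) \<Rightarrow> 'a :: complex_inner set" where
  "orthogonal_to n v = {x. \<forall>i<n. cinner x (v i) = 0}"

lemma compact_op_convergent_subsequence:
  assumes "compact_op K" "\<And>n. norm (x n) \<le> 1"
  obtains l r where "strict_mono (r :: nat \<Rightarrow> nat)" "(\<lambda>n. K (x (r n))) \<longlonglongrightarrow> l"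
proof -
  have "K (x n) \<in> closure (blinfun_apply K ` cball 0 1)" for n
    using assms(2)[of n] closure_subset by fastforce
  then obtain l r where "strict_mono (r :: nat \<Rightarrow> nat)" "((\<lambda>n. K (x n)) \<circ> r) \<longlonglongrightarrow> l"
    using assms(1) unfolding compact_op_def compact_def by metis
  then show ?thesis
    by (intro that[of r l]) (simp_all add: comp_def)
qed

text \<open>
  A right singular vector of \<open>K\<close> in the orthogonal complement of its predecessors, chosen so that the
  norm of \<open>K\<close> on that complement is attained. The zero vector stands for the case that \<open>K\<close> vanishes
  there; the next singular value is then \<open>\<parallel>K 0\<parallel> = 0\<close>.
\<close>
definition singular_vector ::
    "('a :: complex_hilbert \<Rightarrow>\<^sub>L 'a) \<Rightarrow> (nat \<Rightarrow> 'a) \<Rightarrow> nat \<Rightarrow> 'a \<Rightarrow> bool" where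
  "singular_vector K v n x \<longleftrightarrow> x \<in> orthogonal_to n v
      \<and> adjoint_op K (K x) = complex_of_real ((norm (K x))\<^sup>2) *\<^sub>C x
      \<and> (\<forall>y \<in> orthogonal_to n v. norm (K y) \<le> norm (K x) * norm y)
      \<and> (x = 0 \<or> norm x = 1) \<and> (K x = 0 \<longrightarrow> x = 0)"

text \<open>
  Let \<open>s > 0\<close> be the norm of \<open>K\<close> on the complement \<open>M\<close>, which \<open>T = K\<^sup>*K\<close> maps to itself. If \<open>x\<^sub>k\<close> is
  a maximizing sequence, then \<open>T x\<^sub>k - s\<^sup>2 x\<^sub>k\<close> tends to 0, and along a subsequence \<open>T x\<^sub>k\<close> converges
  by compactness of \<open>K\<close>. Thus \<open>x\<^sub>k\<close> itself converges in norm, to a maximizer that is an eigenvector.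
\<close>
lemma ex_singular_vector:
  fixes K :: "'a :: complex_hilbert \<Rightarrow>\<^sub>L 'a"
  assumes K: "K \<in> bounded_operators" "compact_op K"
    and eig: "\<And>i. i < n \<Longrightarrow> adjoint_op K (K (v i)) = c i *\<^sub>C v i"
  shows "\<exists>x. singular_vector K v n x"
proof -
  define M where "M = orthogonal_to n v"
  define T where "T x = adjoint_op K (K x)" for x
  note adj = cinner_adjoint[OF K(1)] cinner_adjoint'[OF K(1)]
  have M0: "0 \<in> M" by (simp add: M_def orthogonal_to_def cinner.zero_left)
  have Mscale: "x \<in> M \<Longrightarrow> r *\<^sub>R x \<in> M" for x and r :: real
    by (simp add: M_def orthogonal_to_def cinner.scaleR_left)
  have TM: "x \<in> M \<Longrightarrow> T x \<in> M" for x
    by (auto simp: M_def orthogonal_to_def T_def adj eig[unfolded adj] cinner_scaleC_right)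
  define S where "S = (\<lambda>x. norm (K x)) ` (M \<inter> cball 0 1)"
  define s where "s = Sup S"
  have bdd: "bdd_above S"
    unfolding S_def
  proof (rule bdd_aboveI2)
    fix x assume "x \<in> M \<inter> cball 0 1"
    then have "norm K * norm x \<le> norm K" by (simp add: mult_left_le)
    then show "norm (K x) \<le> norm K" using norm_blinfun[of K x] by linarith
  qed
  have S0: "0 \<in> S" using M0 by (force simp: S_def blinfun.zero_right)
  have s0: "0 \<le> s" unfolding s_def by (rule cSup_upper[OF S0 bdd])
  have le1: "norm (K x) \<le> s" if "x \<in> M" "norm x \<le> 1" for x
    unfolding s_def using that by (intro cSup_upper[OF _ bdd]) (auto simp: S_def)
  have le: "norm (K x) \<le> s * norm x" if "x \<in> M" for x
  proof (cases "x = 0")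
    case False
    have "norm (K ((1 / norm x) *\<^sub>R x)) \<le> s"
      using False by (intro le1 Mscale that) simp
    then show ?thesis using False by (simp add: blinfun.scaleR_right field_simps)
  qed (simp add: blinfun.zero_right)
  show ?thesis
  proof (cases "s = 0")
    case True
    then have "\<forall>y\<in>M. norm (K y) \<le> norm (K 0) * norm y"
      using le by (simp add: blinfun.zero_right)
    then show ?thesis
      using M0 unfolding singular_vector_def M_def[symmetric]
      by (intro exI[of _ 0]) (simp_all add: blinfun.zero_right)
  next
    case False
    with s0 have spos: "0 < s" by simp
    have "\<exists>x \<in> M. norm x \<le> 1 \<and> s - 1 / (real k + 1) < norm (K x)" for k
    proof -
      have "\<exists>u \<in> S. s - 1 / (real k + 1) < u"
        unfolding s_def using S0 bdd by (intro less_cSupD) auto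
      then show ?thesis by (auto simp: S_def)
    qed
    then obtain x where x: "\<And>k. x k \<in> M" "\<And>k. norm (x k) \<le> 1"
      "\<And>k. s - 1 / (real k + 1) < norm (K (x k))" by metis
    obtain l r where r: "strict_mono (r :: nat \<Rightarrow> nat)" and l: "(\<lambda>k. K (x (r k))) \<longlonglongrightarrow> l"
      by (rule compact_op_convergent_subsequence[OF K(2) x(2)])
    have "(\<lambda>k. norm (K (x k))) \<longlonglongrightarrow> s"
    proof (rule tendsto_sandwich[where f = "\<lambda>k. s - 1 / (real k + 1)" and h = "\<lambda>_. s"])
      have "(\<lambda>n. 1 / (real n + 1)) \<longlonglongrightarrow> 0"
        using LIMSEQ_inverse_real_of_nat by (simp add: inverse_eq_divide add.commute)
      from tendsto_diff[OF tendsto_const this, of s]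
      show "(\<lambda>k. s - 1 / (real k + 1)) \<longlonglongrightarrow> s" by simp
    qed (use x le1 in \<open>auto intro!: always_eventually less_imp_le\<close>)
    from LIMSEQ_subseq_LIMSEQ[OF this r] have lims: "(\<lambda>k. norm (K (x (r k)))) \<longlonglongrightarrow> s"
      by (simp add: comp_def)
    have Tle: "norm (T z) \<le> s * norm (K z)" if "z \<in> M" for z
    proof (cases "T z = 0")
      case False
      have "cinner (T z) (T z) = cinner (K z) (K (T z))"
        unfolding T_def by (rule cinner_adjoint'[OF K(1)])
      then have "(norm (T z))\<^sup>2 = Re (cinner (K z) (K (T z)))"
        by (metis Re_complex_of_real cinner_self)
      also have "\<dots> \<le> cmod (cinner (K z) (K (T z)))" by (rule complex_Re_le_cmod)
      also have "\<dots> \<le> norm (K z) * norm (K (T z))" by (rule cmod_cinner_le)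
      also have "\<dots> \<le> norm (K z) * (s * norm (T z))"
        by (intro mult_left_mono le TM that) simp
      finally show ?thesis using False by (simp add: power2_eq_square mult_ac)
    qed (use spos in simp)
    \<comment> \<open>The maximizing sequence is an approximate eigenvector sequence of \<open>K\<^sup>*K\<close>.\<close>
    have defect: "(norm (T (x k) - (s\<^sup>2) *\<^sub>R x k))\<^sup>2 \<le> s^4 - s\<^sup>2 * (norm (K (x k)))\<^sup>2" for k
    proof -
      have "(norm (T (x k) - (s\<^sup>2) *\<^sub>R x k))\<^sup>2
          = (norm (T (x k)))\<^sup>2 - 2 * s\<^sup>2 * (norm (K (x k)))\<^sup>2 + s^4 * (norm (x k))\<^sup>2"
        unfolding norm_diff_square
        by (simp add: cinner.scaleR_right T_def adj cinner_self power_mult_distrib)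
      moreover have "(norm (T (x k)))\<^sup>2 \<le> (s * norm (K (x k)))\<^sup>2"
        by (intro power_mono Tle x) simp
      moreover have "s^4 * (norm (x k))\<^sup>2 \<le> s^4"
        using x(2)[of k] by (simp add: mult_left_le power_le_one)
      ultimately show ?thesis by (simp add: power_mult_distrib)
    qed
    have "(\<lambda>k. s^4 - s\<^sup>2 * (norm (K (x (r k))))\<^sup>2) \<longlonglongrightarrow> s^4 - s\<^sup>2 * s\<^sup>2"
      by (intro tendsto_intros lims)
    then have lim0: "(\<lambda>k. s^4 - s\<^sup>2 * (norm (K (x (r k))))\<^sup>2) \<longlonglongrightarrow> 0" by simp
    have "(\<lambda>k. (norm (T (x (r k)) - (s\<^sup>2) *\<^sub>R x (r k)))\<^sup>2) \<longlonglongrightarrow> 0"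
      by (rule tendsto_sandwich[OF always_eventually always_eventually tendsto_const lim0])
        (use defect in auto)
    then have "(\<lambda>k. norm (T (x (r k)) - (s\<^sup>2) *\<^sub>R x (r k))) \<longlonglongrightarrow> 0"
      using tendsto_real_sqrt by fastforce
    then have eig0: "(\<lambda>k. T (x (r k)) - (s\<^sup>2) *\<^sub>R x (r k)) \<longlonglongrightarrow> 0"
      by (rule tendsto_norm_zero_cancel)
    have "(\<lambda>k. T (x (r k))) \<longlonglongrightarrow> adjoint_op K l"
      unfolding T_def by (intro tendsto_intros l)
    from tendsto_diff[OF this eig0] have "(\<lambda>k. T (x (r k)) - (T (x (r k)) - (s\<^sup>2) *\<^sub>R x (r k))) \<longlonglongrightarrow> adjoint_op K l - 0" .
    then have "(\<lambda>k. (1 / s\<^sup>2) *\<^sub>R ((s\<^sup>2) *\<^sub>R x (r k))) \<longlonglongrightarrow> (1 / s\<^sup>2) *\<^sub>R adjoint_op K l"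
      by (intro tendsto_intros) simp
    then have xlim: "(\<lambda>k. x (r k)) \<longlonglongrightarrow> (1 / s\<^sup>2) *\<^sub>R adjoint_op K l"
      using spos by simp
    define z where "z = (1 / s\<^sup>2) *\<^sub>R adjoint_op K l"
    note xlim = xlim[folded z_def]
    have zM: "z \<in> M"
    proof -
      have "cinner z (v i) = 0" if "i < n" for i
      proof -
        have "(\<lambda>k. cinner (x (r k)) (v i)) \<longlonglongrightarrow> cinner z (v i)"
          by (intro cinner.tendsto xlim tendsto_const)
        moreover have "(\<lambda>k. cinner (x (r k)) (v i)) = (\<lambda>_. 0)"
          using x(1) that by (auto simp: M_def orthogonal_to_def)
        ultimately show ?thesis by (simp add: LIMSEQ_const_iff)
      qed
      then show ?thesis by (simp add: M_def orthogonal_to_def)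
    qed
    have "(\<lambda>k. norm (K (x (r k)))) \<longlonglongrightarrow> norm (K z)"
      by (intro tendsto_intros xlim)
    with lims have Kz: "norm (K z) = s" using LIMSEQ_unique by blast
    have z1: "norm z \<le> 1"
      using x(2) by (intro LIMSEQ_le_const2[OF tendsto_norm[OF xlim]]) auto
    have "s * 1 \<le> s * norm z" using le[OF zM] Kz by simp
    then have "norm z = 1" using z1 spos by simp
    have "(\<lambda>k. T (x (r k)) - (s\<^sup>2) *\<^sub>R x (r k)) \<longlonglongrightarrow> T z - (s\<^sup>2) *\<^sub>R z"
      unfolding T_def by (intro tendsto_intros xlim)
    from LIMSEQ_unique[OF this eig0] have "T z = (s\<^sup>2) *\<^sub>R z" by simp
    then have "adjoint_op K (K z) = complex_of_real ((norm (K z))\<^sup>2) *\<^sub>C z"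
      by (simp only: T_def Kz scaleC_of_real)
    then show ?thesis
      using zM \<open>norm z = 1\<close> le spos Kz unfolding singular_vector_def M_def[symmetric]
      by (intro exI[of _ z]) auto
  qed
qed

definition singular_system :: "('a :: complex_hilbert \<Rightarrow>\<^sub>L 'a) \<Rightarrow> (nat \<Rightarrow> 'a) \<Rightarrow> bool" where
  "singular_system K v \<longleftrightarrow> (\<forall>n. singular_vector K v n (v n))"

lemma ex_singular_system:
  fixes K :: "'a :: complex_hilbert \<Rightarrow>\<^sub>L 'a"
  assumes K: "K \<in> bounded_operators" "compact_op K"
  shows "\<exists>v. singular_system K v"
  unfolding singular_system_def
proof (rule dependent_wellorder_choice)
  fix r :: 'a and f g :: "nat \<Rightarrow> 'a" and n :: nat
  assume "\<And>y. y < n \<Longrightarrow> f y = g y"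
  then have "orthogonal_to n f = orthogonal_to n g" by (simp add: orthogonal_to_def)
  then show "singular_vector K f n r = singular_vector K g n r"
    by (simp add: singular_vector_def)
next
  fix n :: nat and f :: "nat \<Rightarrow> 'a"
  assume "\<And>y. y < n \<Longrightarrow> singular_vector K f y (f y)"
  then show "\<exists>r. singular_vector K f n r"
    by (intro ex_singular_vector[OF K]) (auto simp only: singular_vector_def)
qed

context
  fixes K :: "'a :: complex_hilbert \<Rightarrow>\<^sub>L 'a" and v :: "nat \<Rightarrow> 'a"
  assumes K: "K \<in> bounded_operators" "compact_op K" and sys: "singular_system K v"
begin

private lemma sysD:
  shows "v n \<in> orthogonal_to n v"
    and "adjoint_op K (K (v n)) = complex_of_real ((norm (K (v n)))\<^sup>2) *\<^sub>C v n"
    and "y \<in> orthogonal_to n v \<Longrightarrow> norm (K y) \<le> norm (K (v n)) * norm y"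
    and "v n = 0 \<or> norm (v n) = 1" and "K (v n) = 0 \<Longrightarrow> v n = 0"
  using sys by (auto simp only: singular_system_def singular_vector_def)

lemma singular_system_orthogonal: "i \<noteq> j \<Longrightarrow> cinner (v i) (v j) = 0"
proof (induction i j rule: linorder_wlog)
  case (le i j)
  then show ?case using sysD(1)[of j] by (auto simp: orthogonal_to_def cinner_zero_sym)
qed (simp add: cinner_zero_sym)

lemma singular_system_norm_le: "norm (v n) \<le> 1"
  using sysD(4)[of n] by auto

lemma singular_system_image_orthogonal: "i \<noteq> j \<Longrightarrow> cinner (K (v i)) (K (v j)) = 0"
  using sysD(2)[of j]
  by (simp add: cinner_adjoint[OF K(1)] cinner_scaleC_right singular_system_orthogonal)

lemma singular_system_decseq: "decseq (\<lambda>n. norm (K (v n)))"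
proof (rule decseq_SucI)
  fix n
  have "v (Suc n) \<in> orthogonal_to n v"
    using sysD(1)[of "Suc n"] by (auto simp: orthogonal_to_def)
  from sysD(3)[OF this] have "norm (K (v (Suc n))) \<le> norm (K (v n)) * norm (v (Suc n))" .
  also have "\<dots> \<le> norm (K (v n))" using singular_system_norm_le by (simp add: mult_left_le)
  finally show "norm (K (v (Suc n))) \<le> norm (K (v n))" .
qed

text \<open>
  Otherwise the vectors \<open>K v\<^sub>n\<close> would be orthogonal with norms bounded below and have no convergent
  subsequence.
\<close>
lemma singular_system_tendsto_0: "(\<lambda>n. norm (K (v n))) \<longlonglongrightarrow> 0"
proof -
  obtain L where L: "(\<lambda>n. norm (K (v n))) \<longlonglongrightarrow> L" "\<And>i. L \<le> norm (K (v i))"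
    using decseq_convergent[OF singular_system_decseq, of 0] by auto
  have L0: "0 \<le> L" by (rule LIMSEQ_le_const[OF L(1)]) auto
  obtain l r where r: "strict_mono (r :: nat \<Rightarrow> nat)" and l: "(\<lambda>n. K (v (r n))) \<longlonglongrightarrow> l"
    by (rule compact_op_convergent_subsequence[OF K(2) singular_system_norm_le])
  have "(\<lambda>n. K (v (r (Suc n))) - K (v (r n))) \<longlonglongrightarrow> l - l"
    by (intro tendsto_diff l LIMSEQ_Suc)
  then have lim: "(\<lambda>n. (norm (K (v (r (Suc n))) - K (v (r n))))\<^sup>2) \<longlonglongrightarrow> (norm (l - l))\<^sup>2"
    by (intro tendsto_power tendsto_norm)
  have "2 * L\<^sup>2 \<le> (norm (K (v (r (Suc n))) - K (v (r n))))\<^sup>2" for n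
  proof -
    have "r (Suc n) \<noteq> r n" using r by (simp add: strict_mono_eq)
    then have "(norm (K (v (r (Suc n))) - K (v (r n))))\<^sup>2
        = (norm (K (v (r (Suc n)))))\<^sup>2 + (norm (K (v (r n))))\<^sup>2"
      by (simp add: norm_diff_square singular_system_image_orthogonal)
    moreover have "L\<^sup>2 \<le> (norm (K (v i)))\<^sup>2" for i
      using L(2) L0 by (intro power_mono)
    ultimately show ?thesis by (smt (verit))
  qed
  then have "2 * L\<^sup>2 \<le> (norm (l - l))\<^sup>2"
    by (intro LIMSEQ_le_const[OF lim]) blast
  then have "L = 0" by simp
  with L(1) show ?thesis by simp
qed

lemma singular_system_remainder:
  "x - (\<Sum>n<N. cinner x (v n) *\<^sub>C v n) \<in> orthogonal_to N v"
proof -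
  have "cinner (\<Sum>n<N. cinner x (v n) *\<^sub>C v n) (v i) = cinner x (v i)" if "i < N" for i
  proof -
    have "cinner (\<Sum>n<N. cinner x (v n) *\<^sub>C v n) (v i)
        = (\<Sum>n<N. cinner x (v n) * cinner (v n) (v i))"
      by (simp add: cinner.sum_left cinner_scaleC_left)
    also have "\<dots> = (\<Sum>n<N. if n = i then cinner x (v i) * cinner (v i) (v i) else 0)"
      by (intro sum.cong) (auto simp: singular_system_orthogonal)
    also have "\<dots> = cinner x (v i) * cinner (v i) (v i)" using that by simp
    also have "\<dots> = cinner x (v i)"
      using sysD(4)[of i] by (auto simp: cinner_self cinner.zero_right)
    finally show ?thesis .
  qed
  then show ?thesis by (simp add: orthogonal_to_def cinner.diff_left)
qed

lemma orthogonal_to_all_imp_kernel: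
  assumes "\<And>n. cinner x (v n) = 0"
  shows "K x = 0"
proof -
  have "norm (K x) \<le> norm (K (v n)) * norm x" for n
    using assms by (intro sysD(3)) (simp add: orthogonal_to_def)
  moreover have "(\<lambda>n. norm (K (v n)) * norm x) \<longlonglongrightarrow> 0 * norm x"
    by (intro tendsto_intros singular_system_tendsto_0)
  ultimately have "norm (K x) \<le> 0 * norm x"
    by (intro LIMSEQ_le_const) auto
  then show ?thesis by simp
qed

text \<open>
  The remainder after \<open>N\<close> terms is the image under \<open>K\<close> of a vector orthogonal to the first \<open>N\<close>
  singular vectors, where the norm of \<open>K\<close> is the next singular value.
\<close>
lemma singular_system_expansion:
  "(\<lambda>N. \<Sum>n<N. cinner x (v n) * cinner (K (v n)) y) \<longlonglongrightarrow> cinner (K x) y"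
proof -
  have le: "norm (K x - (\<Sum>n<N. cinner x (v n) *\<^sub>C K (v n))) \<le> norm (K (v N)) * norm x" for N
  proof -
    define z where "z = x - (\<Sum>n<N. cinner x (v n) *\<^sub>C v n)"
    define w where "w = (\<Sum>n<N. cinner x (v n) *\<^sub>C v n)"
    have zM: "z \<in> orthogonal_to N v" unfolding z_def by (rule singular_system_remainder)
    have "cinner (v i) z = 0" if "i < N" for i
      using zM that by (simp add: orthogonal_to_def cinner_zero_sym[of "v i"])
    then have "cinner w z = 0"
      by (simp add: w_def cinner.sum_left cinner_scaleC_left)
    then have "(norm (w + z))\<^sup>2 = (norm w)\<^sup>2 + (norm z)\<^sup>2" by (simp add: norm_add_square)
    then have "(norm z)\<^sup>2 \<le> (norm x)\<^sup>2" by (simp add: z_def w_def)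
    then have zx: "norm z \<le> norm x" by simp
    have "K x - (\<Sum>n<N. cinner x (v n) *\<^sub>C K (v n)) = K z"
      by (simp add: z_def blinfun.diff_right blinfun.sum_right bounded_operators_scaleC[OF K(1)])
    then show ?thesis
      using sysD(3)[OF zM] mult_left_mono[OF zx, of "norm (K (v N))"] by simp
  qed
  have "(\<lambda>N. norm (K (v N)) * norm x) \<longlonglongrightarrow> 0"
    by (rule tendsto_mult_left_zero[OF singular_system_tendsto_0])
  then have "(\<lambda>N. K x - (\<Sum>n<N. cinner x (v n) *\<^sub>C K (v n))) \<longlonglongrightarrow> 0"
    by (rule Lim_null_comparison[OF always_eventually, rotated]) (intro allI le)
  then have "(\<lambda>N. cinner (K x - (K x - (\<Sum>n<N. cinner x (v n) *\<^sub>C K (v n)))) y)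
      \<longlonglongrightarrow> cinner (K x - 0) y"
    by (intro cinner.tendsto tendsto_diff tendsto_const)
  then show ?thesis by (simp add: cinner.sum_left cinner_scaleC_left)
qed

text \<open>
  The vectors \<open>v\<^sub>n\<close> with \<open>\<parallel>K v\<^sub>n\<parallel> = t\<close> form a basis of the eigenspace of \<open>K\<^sup>*K\<close> for \<open>t\<^sup>2\<close>: after
  subtracting its components along them, an eigenvector is orthogonal to all \<open>v\<^sub>n\<close>, hence lies in the
  kernel of \<open>K\<close>, and it vanishes since \<open>t \<noteq> 0\<close>.
\<close>
lemma singular_system_multiplicity:
  assumes t: "0 < t"
  shows "finite {n. norm (K (v n)) = t}"
    and "card {n. norm (K (v n)) = t}
      = complex_vector.dim {x. (adjoint_op K o\<^sub>L K) x = complex_of_real (t\<^sup>2) *\<^sub>C x}"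
proof -
  define I where "I = {n. norm (K (v n)) = t}"
  define W where "W = {x. (adjoint_op K o\<^sub>L K) x = complex_of_real (t\<^sup>2) *\<^sub>C x}"
  have "\<forall>\<^sub>F n in sequentially. norm (K (v n)) < t"
    using order_tendstoD(2)[OF singular_system_tendsto_0 t] .
  then obtain N where "\<And>n. N \<le> n \<Longrightarrow> norm (K (v n)) < t"
    unfolding eventually_sequentially by blast
  then have "I \<subseteq> {..<N}" by (fastforce simp: I_def not_less[symmetric])
  then show finI: "finite {n. norm (K (v n)) = t}"
    unfolding I_def[symmetric] using finite_subset by blast
  have norm1: "norm (v n) = 1" if "n \<in> I" for n
    using sysD(4)[of n] that t by (auto simp: I_def blinfun.zero_right)
  have inj: "inj_on v I"
  proof (rule inj_onI)
    fix i j assume ij: "i \<in> I" "j \<in> I" "v i = v j"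
    show "i = j"
    proof (rule ccontr)
      assume "i \<noteq> j"
      from singular_system_orthogonal[OF this] ij norm1[of j] show False
        by (simp add: cinner_self)
    qed
  qed
  have indep: "complex_vector.independent (v ` I)"
  proof (rule complex_vector.independent_if_scalars_zero)
    show "finite (v ` I)" using finI by (simp add: I_def)
    fix f x assume sum0: "(\<Sum>x\<in>v ` I. f x *\<^sub>C x) = 0" and "x \<in> v ` I"
    then obtain i where i: "i \<in> I" "x = v i" by blast
    have "0 = cinner (\<Sum>x\<in>v ` I. f x *\<^sub>C x) (v i)" by (simp add: sum0 cinner.zero_left)
    also have "\<dots> = (\<Sum>j\<in>I. f (v j) * cinner (v j) (v i))"
      by (simp add: sum.reindex[OF inj] cinner.sum_left cinner_scaleC_left)
    also have "\<dots> = (\<Sum>j\<in>I. if j = i then f (v i) else 0)"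
      using norm1 i by (intro sum.cong) (auto simp: singular_system_orthogonal cinner_self)
    also have "\<dots> = f x" using i finI by (simp add: I_def)
    finally show "f x = 0" by simp
  qed
  have sub: "v ` I \<subseteq> W" using sysD(2) by (auto simp: I_def W_def)
  have "W \<subseteq> complex_vector.span (v ` I)"
  proof
    fix x assume "x \<in> W"
    then have Tx: "adjoint_op K (K x) = complex_of_real (t\<^sup>2) *\<^sub>C x" by (simp add: W_def)
    define y where "y = (\<Sum>n\<in>I. cinner x (v n) *\<^sub>C v n)"
    have yspan: "y \<in> complex_vector.span (v ` I)"
      unfolding y_def
      by (intro complex_vector.span_sum complex_vector.span_scale complex_vector.span_base) auto
    have Ty: "adjoint_op K (K y) = complex_of_real (t\<^sup>2) *\<^sub>C y"
      using sysD(2)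
      by (simp add: y_def blinfun.sum_right bounded_operators_scaleC[OF K(1)]
          bounded_operators_scaleC[OF adjoint_op_bounded_operators[OF K(1)]] I_def
          complex_vector.scale_sum_right scaleC_scaleC mult.commute)
    have "cinner (x - y) (v i) = 0" for i
    proof (cases "i \<in> I")
      case True
      have "cinner y (v i) = (\<Sum>n\<in>I. cinner x (v n) * cinner (v n) (v i))"
        by (simp add: y_def cinner.sum_left cinner_scaleC_left)
      also have "\<dots> = (\<Sum>n\<in>I. if n = i then cinner x (v i) else 0)"
        using norm1 True
        by (intro sum.cong) (auto simp: singular_system_orthogonal cinner_self)
      also have "\<dots> = cinner x (v i)" using True finI by (simp add: I_def)
      finally show ?thesis by (simp add: cinner.diff_left)
    next
      case False
      have *: "complex_of_real (t\<^sup>2) * cinner (x - y) (v i)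
          = complex_of_real ((norm (K (v i)))\<^sup>2) * cinner (x - y) (v i)"
      proof -
        have "complex_of_real (t\<^sup>2) * cinner (x - y) (v i)
            = cinner (adjoint_op K (K (x - y))) (v i)"
          by (simp add: Tx Ty blinfun.diff_right cinner_simps algebra_simps del: of_real_power)
        also have "\<dots> = cinner (x - y) (adjoint_op K (K (v i)))"
          by (simp add: cinner_adjoint[OF K(1)] cinner_adjoint'[OF K(1)])
        also have "\<dots> = complex_of_real ((norm (K (v i)))\<^sup>2) * cinner (x - y) (v i)"
          by (subst sysD(2)) (simp only: cinner_scaleC_right complex_cnj_complex_of_real)
        finally show ?thesis .
      qed
      have "t\<^sup>2 \<noteq> (norm (K (v i)))\<^sup>2"
        using False t by (auto simp: I_def power2_eq_iff_nonneg)
      with * show ?thesis by (metis mult_cancel_right of_real_eq_iff)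
    qed
    then have "K (x - y) = 0" by (rule orthogonal_to_all_imp_kernel)
    then have "complex_of_real (t\<^sup>2) *\<^sub>C (x - y) = 0"
      using Tx Ty by (metis blinfun.diff_right blinfun.zero_right
          complex_vector.scale_right_diff_distrib)
    then have "x = y" using t by auto
    with yspan show "x \<in> complex_vector.span (v ` I)" by simp
  qed
  from complex_vector.basis_card_eq_dim[OF sub this indep]
  show "card {n. norm (K (v n)) = t}
      = complex_vector.dim {x. (adjoint_op K o\<^sub>L K) x = complex_of_real (t\<^sup>2) *\<^sub>C x}"
    using card_image[OF inj] by (simp only: I_def W_def)
qed

end

text \<open>
  At the first index where the two sequences differ, the larger of the two values occurs at least once
  more in its sequence than in the other.
\<close>
lemma decseq_eqI_multiplicity:
  fixes s s' :: "nat \<Rightarrow> real"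
  assumes "decseq s" "decseq s'" "\<And>n. 0 \<le> s n" "\<And>n. 0 \<le> s' n"
    and fin: "\<And>t. 0 < t \<Longrightarrow> finite {n. s n = t}" "\<And>t. 0 < t \<Longrightarrow> finite {n. s' n = t}"
    and card: "\<And>t. 0 < t \<Longrightarrow> card {n. s n = t} = card {n. s' n = t}"
  shows "s = s'"
proof
  fix n
  have less_impossible: False
    if "\<forall>i<n. s i = s' i" "s n < s' n" "decseq s" "0 \<le> s n"
      "\<And>t. 0 < t \<Longrightarrow> finite {n. s' n = t}"
      "\<And>t. 0 < t \<Longrightarrow> card {n. s n = t} = card {n. s' n = t}" for s s' :: "nat \<Rightarrow> real" and n
  proof -
    define u where "u = s' n"
    have "{i. s i = u} \<subseteq> {i. s' i = u} - {n}"
    proof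
      fix i assume "i \<in> {i. s i = u}"
      then have i: "s i = u" by simp
      have "i < n"
      proof (rule ccontr)
        assume "\<not> i < n"
        then have "s i \<le> s n" using \<open>decseq s\<close> by (simp add: decseqD)
        with i that(2) show False by (simp add: u_def)
      qed
      with i that(1) show "i \<in> {i. s' i = u} - {n}" by auto
    qed
    moreover have "finite {i. s' i = u}" and n: "n \<in> {i. s' i = u}"
      using that by (auto simp: u_def)
    ultimately have "card {i. s i = u} \<le> card ({i. s' i = u} - {n})"
      by (intro card_mono) auto
    also have "\<dots> < card {i. s' i = u}"
      using n \<open>finite {i. s' i = u}\<close> by (intro card_Diff1_less) auto
    finally show False using that by (simp add: u_def)
  qed
  show "s n = s' n"
  proof (induction n rule: less_induct)
    case (less n)
    then show ?case
      using less_impossible[of n s s'] less_impossible[of n s' s] assms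
      by (metis linorder_neqE_linordered_idom)
  qed
qed

lemma singular_value_eq:
  assumes K: "K \<in> bounded_operators" "compact_op K" and sys: "singular_system K v"
  shows "singular_value K n = norm (K (v n))"
proof -
  note props = singular_system_decseq[OF assms] singular_system_multiplicity[OF assms]
  have "singular_value K = (\<lambda>n. norm (K (v n)))"
    unfolding singular_value_def
  proof (rule the_equality)
    show "decseq (\<lambda>n. norm (K (v n))) \<and> (\<forall>n. 0 \<le> norm (K (v n))) \<and>
      (\<forall>t>0. finite {n. norm (K (v n)) = t} \<and> card {n. norm (K (v n)) = t} =
        complex_vector.dim {x. (adjoint_op K o\<^sub>L K) x = complex_of_real (t\<^sup>2) *\<^sub>C x})"
      using props by simp
  qed (rule decseq_eqI_multiplicity; use props in simp)
  then show ?thesis by simp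
qed

section \<open>The diagonal of a Schatten class operator\<close>

lemma powr_tangent_line:
  fixes x y p :: real
  assumes "1 \<le> p" "0 \<le> x" "0 < y"
  shows "y powr p + p * y powr (p - 1) * (x - y) \<le> x powr p"
proof (cases "x = 0")
  case True
  have "y powr p = y powr (p - 1) * y"
    using assms by (simp add: powr_mult_base mult.commute)
  then show ?thesis using True assms by (simp add: algebra_simps mult_right_mono)
next
  case False
  have "p * y powr (p - 1) * (x - y) \<le> x powr p - y powr p"
  proof (rule convex_on_imp_above_tangent[OF powr_convex[OF assms(1)]])
    show "((\<lambda>x. x powr p) has_real_derivative p * y powr (p - 1)) (at y within {0<..})"
      using assms by (auto intro!: derivative_eq_intros)
  qed (use assms False in \<open>auto simp: interior_open\<close>)
  then show ?thesis by simp
qed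

text \<open>
  Jensen's inequality for weights of total mass at most 1, which follows by adding up tangent line
  inequalities at the weighted sum; the missing mass only helps because \<open>p \<ge> 1\<close>.
\<close>
lemma powr_weighted_sum_le:
  fixes b s :: "'i \<Rightarrow> real"
  assumes p: "1 \<le> p" and b: "\<And>i. i \<in> I \<Longrightarrow> 0 \<le> b i" "(\<Sum>i\<in>I. b i) \<le> 1"
    and s: "\<And>i. i \<in> I \<Longrightarrow> 0 \<le> s i"
  shows "(\<Sum>i\<in>I. b i * s i) powr p \<le> (\<Sum>i\<in>I. b i * s i powr p)"
proof -
  define y where "y = (\<Sum>i\<in>I. b i * s i)"
  have "0 \<le> y" unfolding y_def using b s by (intro sum_nonneg) simp
  show ?thesis
  proof (cases "y = 0")
    case True
    then show ?thesis using b by (auto simp: y_def intro!: sum_nonneg)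
  next
    case False
    with \<open>0 \<le> y\<close> have y: "0 < y" by simp
    define m where "m = (\<Sum>i\<in>I. b i)"
    have yp: "y powr p = y powr (p - 1) * y"
      using y by (simp add: powr_mult_base mult.commute)
    have "y powr p * 1 \<le> y powr p * (m + p * (1 - m))"
    proof (rule mult_left_mono)
      have "0 \<le> (p - 1) * (1 - m)" using p b(2) by (simp add: m_def)
      then show "1 \<le> m + p * (1 - m)" by (simp add: algebra_simps)
    qed simp
    also have "\<dots> = (\<Sum>i\<in>I. b i * (y powr p + p * y powr (p - 1) * (s i - y)))"
    proof -
      have "(\<Sum>i\<in>I. b i * (y powr p + p * y powr (p - 1) * (s i - y)))
          = (\<Sum>i\<in>I. (y powr p - p * y powr (p - 1) * y) * b i + p * y powr (p - 1) * (b i * s i))"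
        by (intro sum.cong) (simp_all add: algebra_simps)
      also have "\<dots> = (y powr p - p * y powr (p - 1) * y) * m + p * y powr (p - 1) * y"
        by (simp add: sum.distrib m_def y_def flip: sum_distrib_left)
      finally show ?thesis by (simp add: yp algebra_simps)
    qed
    also have "\<dots> \<le> (\<Sum>i\<in>I. b i * s i powr p)"
      using b s y p by (intro sum_mono mult_left_mono powr_tangent_line) auto
    finally show ?thesis by (simp add: y_def)
  qed
qed

text \<open>
  With \<open>K v\<^sub>n = s\<^sub>n u\<^sub>n\<close>, the expansion of \<open>K\<close> gives \<open>|\<langle>K e\<^sub>i, e\<^sub>i\<rangle>| \<le> \<Sum>\<^sub>n b\<^sub>i\<^sub>n s\<^sub>n\<close>, where
  \<open>b\<^sub>i\<^sub>n = (|\<langle>e\<^sub>i, v\<^sub>n\<rangle>|\<^sup>2 + |\<langle>e\<^sub>i, u\<^sub>n\<rangle>|\<^sup>2) / 2\<close>. By Bessel's inequality the rows and the columns of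
  \<open>b\<close> have sums at most 1: the bound on rows permits Jensen's inequality, the one on columns the
  summation over \<open>i\<close>. All this is done for partial sums of the expansion, before passing to the limit.
\<close>
lemma sum_diagonal_powr_le:
  fixes K :: "'a :: complex_hilbert \<Rightarrow>\<^sub>L 'a" and e :: "'i \<Rightarrow> 'a"
  assumes K: "K \<in> schatten_class p" and p: "1 \<le> p" and fin: "finite I"
    and norm_e: "\<And>i. i \<in> I \<Longrightarrow> norm (e i) = 1"
    and orth_e: "\<And>i j. i \<in> I \<Longrightarrow> j \<in> I \<Longrightarrow> i \<noteq> j \<Longrightarrow> cinner (e i) (e j) = 0"
  shows "(\<Sum>i\<in>I. cmod (cinner (K (e i)) (e i)) powr p) \<le> schatten_norm p K powr p"
proof -
  have K': "K \<in> bounded_operators" "compact_op K"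
    and summ: "summable (\<lambda>n. singular_value K n powr p)"
    using K by (auto simp: schatten_class_def)
  obtain v where sys: "singular_system K v" using ex_singular_system[OF K'] by blast
  note sv = singular_value_eq[OF K' sys]
  define s where "s n = norm (K (v n))" for n
  define u where "u n = (1 / s n) *\<^sub>R K (v n)" for n
  have s0: "0 \<le> s n" for n by (simp add: s_def)
  have Ku: "K (v n) = s n *\<^sub>R u n" for n by (simp add: u_def s_def)
  have u_norm: "norm (u n) \<le> 1" for n by (simp add: u_def s_def)
  have u_orth: "n \<noteq> m \<Longrightarrow> cinner (u n) (u m) = 0" for n m
    by (simp add: u_def cinner.scaleR_left cinner.scaleR_right
        singular_system_image_orthogonal[OF K' sys])
  define b where "b i n = ((cmod (cinner (e i) (v n)))\<^sup>2 + (cmod (cinner (e i) (u n)))\<^sup>2) / 2" for i n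
  have b0: "0 \<le> b i n" for i n by (simp add: b_def)
  have row: "(\<Sum>n<N. b i n) \<le> 1" if "i \<in> I" for i N
  proof -
    have "(\<Sum>n<N. (cmod (cinner (e i) (v n)))\<^sup>2) \<le> (norm (e i))\<^sup>2"
      by (intro bessel_finite)
        (auto intro: singular_system_orthogonal[OF K' sys] singular_system_norm_le[OF K' sys])
    moreover have "(\<Sum>n<N. (cmod (cinner (e i) (u n)))\<^sup>2) \<le> (norm (e i))\<^sup>2"
      by (intro bessel_finite) (auto intro: u_orth u_norm)
    ultimately show ?thesis
      using norm_e[OF that] by (simp add: b_def sum.distrib flip: sum_divide_distrib)
  qed
  have col: "(\<Sum>i\<in>I. b i n) \<le> 1" for n
  proof -
    have *: "(\<Sum>i\<in>I. (cmod (cinner (e i) x))\<^sup>2) \<le> 1" if "norm x \<le> 1" for x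
    proof -
      have "(\<Sum>i\<in>I. (cmod (cinner (e i) x))\<^sup>2) = (\<Sum>i\<in>I. (cmod (cinner x (e i)))\<^sup>2)"
        by (intro sum.cong refl) (metis cinner_commute complex_mod_cnj)
      also have "\<dots> \<le> (norm x)\<^sup>2"
        using norm_e orth_e by (intro bessel_finite fin) auto
      also have "\<dots> \<le> 1" using that by (simp add: power_le_one)
      finally show ?thesis .
    qed
    show ?thesis
      using *[of "v n"] *[of "u n"] singular_system_norm_le[OF K' sys, of n] u_norm[of n]
      by (simp add: b_def sum.distrib flip: sum_divide_distrib)
  qed
  have total: "(\<Sum>n<N. s n powr p) \<le> (\<Sum>n. s n powr p)" for N
    using summ by (intro sum_le_suminf) (auto simp: sv s_def)
  define a where "a i N = (\<Sum>n<N. cinner (e i) (v n) * cinner (K (v n)) (e i))" for i N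
  have "(\<Sum>i\<in>I. cmod (a i N) powr p) \<le> (\<Sum>n. s n powr p)" for N
  proof -
    have "cmod (a i N) \<le> (\<Sum>n<N. b i n * s n)" for i
      unfolding a_def
    proof (rule sum_norm_le)
      fix n
      have "cmod (cinner (e i) (v n)) * cmod (cinner (e i) (u n)) \<le> b i n"
        using sum_squares_bound[of "cmod (cinner (e i) (v n))" "cmod (cinner (e i) (u n))"]
        by (simp add: b_def)
      from mult_right_mono[OF this s0[of n]]
      show "cmod (cinner (e i) (v n) * cinner (K (v n)) (e i)) \<le> b i n * s n"
        using s0[of n] cinner_commute[of "u n" "e i"]
        by (simp add: Ku cinner.scaleR_left norm_mult mult_ac)
    qed
    then have "(\<Sum>i\<in>I. cmod (a i N) powr p) \<le> (\<Sum>i\<in>I. (\<Sum>n<N. b i n * s n) powr p)"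
      using p by (intro sum_mono powr_mono2) auto
    also have "\<dots> \<le> (\<Sum>i\<in>I. \<Sum>n<N. b i n * s n powr p)"
      using p b0 row s0 by (intro sum_mono powr_weighted_sum_le) auto
    also have "\<dots> = (\<Sum>n<N. (\<Sum>i\<in>I. b i n) * s n powr p)"
      by (subst sum.swap) (simp add: sum_distrib_right)
    also have "\<dots> \<le> (\<Sum>n<N. s n powr p)"
      using col by (intro sum_mono) (simp add: mult_left_le_one_le sum_nonneg b0)
    also note total
    finally show ?thesis .
  qed
  moreover have "(\<lambda>N. \<Sum>i\<in>I. cmod (a i N) powr p)
      \<longlonglongrightarrow> (\<Sum>i\<in>I. cmod (cinner (K (e i)) (e i)) powr p)"
    unfolding a_def using p
    by (intro tendsto_sum tendsto_powr' tendsto_norm singular_system_expansion[OF K' sys] tendsto_const)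
       auto
  ultimately have "(\<Sum>i\<in>I. cmod (cinner (K (e i)) (e i)) powr p) \<le> (\<Sum>n. s n powr p)"
    by (intro LIMSEQ_le_const2) auto
  also have "\<dots> = schatten_norm p K powr p"
    using p suminf_nonneg[OF summ]
    by (simp add: schatten_norm_def powr_powr sv s_def)
  finally show ?thesis .
qed

section \<open>Resolvents\<close>

lemma is_inverse_op_unique:
  assumes "is_inverse_op A B" "is_inverse_op A C"
  shows "B = C"
  using assms unfolding is_inverse_op_def
  by (metis blinfun_apply_blinfun_compose blinfun_apply_id_blinfun blinfun_eqI)

lemma resolvent_is_inverse:
  assumes "\<mu> \<notin> spectrum A"
  shows "is_inverse_op (scalar_op \<mu> - A) (resolvent A \<mu>)"
proof -
  obtain B where B: "is_inverse_op (scalar_op \<mu> - A) B"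
    using assms by (auto simp: spectrum_def)
  show ?thesis unfolding resolvent_def
    by (rule theI[of _ B]) (use B is_inverse_op_unique in auto)
qed

lemma
  assumes "\<mu> \<notin> spectrum A"
  shows resolvent_bounded_operators: "resolvent A \<mu> \<in> bounded_operators"
    and resolvent_right: "\<mu> *\<^sub>C resolvent A \<mu> x - A (resolvent A \<mu> x) = x"
    and resolvent_left: "resolvent A \<mu> (\<mu> *\<^sub>C x - A x) = x"
proof -
  have "is_inverse_op (scalar_op \<mu> - A) (resolvent A \<mu>)"
    by (rule resolvent_is_inverse[OF assms])
  then have B: "resolvent A \<mu> \<in> bounded_operators"
    and R: "(scalar_op \<mu> - A) o\<^sub>L resolvent A \<mu> = id_blinfun"
    and L: "resolvent A \<mu> o\<^sub>L (scalar_op \<mu> - A) = id_blinfun"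
    by (auto simp: is_inverse_op_def)
  show "resolvent A \<mu> \<in> bounded_operators" by (rule B)
  show "\<mu> *\<^sub>C resolvent A \<mu> x - A (resolvent A \<mu> x) = x"
    using arg_cong[OF R, of "\<lambda>F. blinfun_apply F x"] by (simp add: blinfun.diff_left)
  show "resolvent A \<mu> (\<mu> *\<^sub>C x - A x) = x"
    using arg_cong[OF L, of "\<lambda>F. blinfun_apply F x"] by (simp add: blinfun.diff_left)
qed

lemma resolvent_commute:
  assumes A: "A \<in> bounded_operators" and \<mu>: "\<mu> \<notin> spectrum A"
  shows "A (resolvent A \<mu> x) = resolvent A \<mu> (A x)"
  using resolvent_right[OF \<mu>, of x] resolvent_left[OF \<mu>, of x]
    bounded_operators_scaleC[OF resolvent_bounded_operators[OF \<mu>], of \<mu> x]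
  by (simp add: blinfun.diff_right algebra_simps)

lemma resolvent_identity:
  assumes A: "A \<in> bounded_operators" and \<mu>: "\<mu> \<notin> spectrum A" and \<nu>: "\<nu> \<notin> spectrum A"
  shows "resolvent A \<mu> x - resolvent A \<nu> x = (\<nu> - \<mu>) *\<^sub>C resolvent A \<mu> (resolvent A \<nu> x)"
proof -
  define y where "y = resolvent A \<nu> x"
  have "x = (\<nu> - \<mu>) *\<^sub>C y + (\<mu> *\<^sub>C y - A y)"
    using resolvent_right[OF \<nu>, of x]
    by (simp add: y_def complex_vector.scale_left_diff_distrib)
  then have "resolvent A \<mu> x = (\<nu> - \<mu>) *\<^sub>C resolvent A \<mu> y + y"
    by (metis blinfun.add_right bounded_operators_scaleC resolvent_bounded_operators[OF \<mu>]
        resolvent_left[OF \<mu>])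
  then show ?thesis by (simp add: y_def)
qed

text \<open>
  The equation \<open>\<nu> x - A x = y\<close> is equivalent to the fixed point equation
  \<open>x = (\<mu> - A)\<^sup>-\<^sup>1 (y - (\<nu> - \<mu>) x)\<close> of a contraction; solving it replaces the Neumann series.
\<close>
lemma resolvent_perturbation:
  assumes A: "A \<in> bounded_operators" and \<mu>: "\<mu> \<notin> spectrum A"
    and small: "cmod (\<nu> - \<mu>) * norm (resolvent A \<mu>) < 1"
  shows "\<nu> \<notin> spectrum A"
proof -
  define R where "R = resolvent A \<mu>"
  define d where "d = cmod (\<nu> - \<mu>) * norm R"
  have d: "0 \<le> d" "d < 1" using small by (simp_all add: d_def R_def)
  note RB = resolvent_bounded_operators[OF \<mu>, folded R_def]
  have eq: "\<nu> *\<^sub>C x - A x = y \<longleftrightarrow> x = R (y - (\<nu> - \<mu>) *\<^sub>C x)" for x y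
  proof -
    have "\<nu> *\<^sub>C x - A x = y \<longleftrightarrow> \<mu> *\<^sub>C x - A x = y - (\<nu> - \<mu>) *\<^sub>C x"
      by (auto simp: complex_vector.scale_left_diff_distrib algebra_simps)
    also have "\<dots> \<longleftrightarrow> x = R (y - (\<nu> - \<mu>) *\<^sub>C x)"
      unfolding R_def using resolvent_left[OF \<mu>] resolvent_right[OF \<mu>] by metis
    finally show ?thesis .
  qed
  have "\<exists>!x. R (y - (\<nu> - \<mu>) *\<^sub>C x) = x" for y
  proof (rule banach_fix_type[OF d], intro allI)
    fix x x'
    have "dist (R (y - (\<nu> - \<mu>) *\<^sub>C x)) (R (y - (\<nu> - \<mu>) *\<^sub>C x'))
        = norm (R ((\<nu> - \<mu>) *\<^sub>C (x' - x)))"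
      by (simp add: dist_norm complex_vector.scale_right_diff_distrib flip: blinfun.diff_right)
    also have "\<dots> \<le> norm R * norm ((\<nu> - \<mu>) *\<^sub>C (x' - x))" by (rule norm_blinfun)
    also have "\<dots> = d * dist x x'"
      by (simp add: d_def norm_scaleC dist_norm norm_minus_commute)
    finally show "dist (R (y - (\<nu> - \<mu>) *\<^sub>C x)) (R (y - (\<nu> - \<mu>) *\<^sub>C x')) \<le> d * dist x x'" .
  qed
  then have ex1: "\<exists>!x. \<nu> *\<^sub>C x - A x = y" for y by (metis eq)
  then obtain b where b: "\<And>y. \<nu> *\<^sub>C b y - A (b y) = y" by metis
  have b': "b (\<nu> *\<^sub>C x - A x) = x" for x using ex1 b by metis
  have bI: "b y = x" if "\<nu> *\<^sub>C x - A x = y" for x y using that b' by auto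
  have add: "b (y + z) = b y + b z" for y z
    using b[of y] b[of z]
    by (intro bI) (simp add: blinfun.add_right scaleC_add_right algebra_simps)
  have scale: "b (c *\<^sub>C y) = c *\<^sub>C b y" for c y
  proof (rule bI)
    have "\<nu> *\<^sub>C c *\<^sub>C b y - A (c *\<^sub>C b y) = c *\<^sub>C (\<nu> *\<^sub>C b y - A (b y))"
      by (simp add: bounded_operators_scaleC[OF A] scaleC_scaleC mult.commute
          complex_vector.scale_right_diff_distrib)
    then show "\<nu> *\<^sub>C c *\<^sub>C b y - A (c *\<^sub>C b y) = c *\<^sub>C y" by (simp add: b)
  qed
  have bd: "norm (b y) \<le> norm y * (norm R / (1 - d))" for y
  proof -
    have "b y = R (y - (\<nu> - \<mu>) *\<^sub>C b y)" using b eq by blast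
    then have "norm (b y) \<le> norm R * norm (y - (\<nu> - \<mu>) *\<^sub>C b y)"
      using norm_blinfun by metis
    also have "\<dots> \<le> norm R * (norm y + cmod (\<nu> - \<mu>) * norm (b y))"
      using norm_triangle_ineq4[of y "(\<nu> - \<mu>) *\<^sub>C b y"]
      by (intro mult_left_mono) (simp_all add: norm_scaleC)
    also have "\<dots> = norm R * norm y + d * norm (b y)" by (simp add: d_def algebra_simps)
    finally show ?thesis using d by (simp add: field_simps)
  qed
  have "bounded_linear b"
    by (rule bounded_linear_intro[OF add _ bd]) (simp add: scale flip: scaleC_of_real)
  then have app: "blinfun_apply (Blinfun b) = b" by (rule bounded_linear_Blinfun_apply)
  have "is_inverse_op (scalar_op \<nu> - A) (Blinfun b)"
    unfolding is_inverse_op_def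
    by (auto intro!: blinfun_eqI simp: in_bounded_operators app scale blinfun.diff_left b b')
  then show ?thesis by (auto simp: spectrum_def)
qed

lemma closed_spectrum:
  assumes A: "A \<in> bounded_operators"
  shows "closed (spectrum A)"
  unfolding closed_def
proof (rule openI)
  fix \<mu> assume "\<mu> \<in> - spectrum A"
  then have \<mu>: "\<mu> \<notin> spectrum A" by simp
  have "ball \<mu> (1 / (norm (resolvent A \<mu>) + 1)) \<subseteq> - spectrum A"
  proof
    fix \<nu> assume "\<nu> \<in> ball \<mu> (1 / (norm (resolvent A \<mu>) + 1))"
    then have "cmod (\<nu> - \<mu>) < 1 / (norm (resolvent A \<mu>) + 1)"
      by (simp add: dist_norm norm_minus_commute)
    then have "cmod (\<nu> - \<mu>) * (norm (resolvent A \<mu>) + 1) < 1"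
      by (simp add: pos_less_divide_eq add_nonneg_pos)
    then have "cmod (\<nu> - \<mu>) * norm (resolvent A \<mu>) < 1"
      using norm_ge_zero[of "\<nu> - \<mu>"] unfolding distrib_left mult_1_right by linarith
    from resolvent_perturbation[OF A \<mu> this] show "\<nu> \<in> - spectrum A" by simp
  qed
  then show "\<exists>e>0. ball \<mu> e \<subseteq> - spectrum A"
    by (intro exI[of _ "1 / (norm (resolvent A \<mu>) + 1)"]) (simp add: add_nonneg_pos)
qed

lemma resolvent_difference:
  assumes A: "A \<in> bounded_operators" and \<mu>: "\<mu> \<notin> spectrum A" and \<nu>: "\<nu> \<notin> spectrum A"
  shows "resolvent A \<nu> - resolvent A \<mu> = - (scalar_op (\<nu> - \<mu>) o\<^sub>L (resolvent A \<nu> o\<^sub>L resolvent A \<mu>))"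
  using resolvent_identity[OF A \<nu> \<mu>]
  by (intro blinfun_eqI) (simp add: blinfun.diff_left blinfun.minus_left
      flip: complex_vector.scale_minus_left)

lemma norm_scalar_op_compose_le: "norm (scalar_op c o\<^sub>L B) \<le> cmod c * norm B"
proof (rule norm_blinfun_bound)
  fix x
  show "norm ((scalar_op c o\<^sub>L B) x) \<le> cmod c * norm B * norm x"
    using mult_left_mono[OF norm_blinfun[of B x], of "cmod c"]
    by (simp add: norm_scaleC mult.assoc)
qed simp

lemma continuous_resolvent:
  assumes A: "A \<in> bounded_operators" and \<mu>: "\<mu> \<notin> spectrum A"
  shows "(resolvent A \<longlongrightarrow> resolvent A \<mu>) (at \<mu>)"
proof -
  define R where "R = resolvent A \<mu>"
  have near: "\<forall>\<^sub>F \<nu> in at \<mu>. cmod (\<nu> - \<mu>) * norm R < 1 / 2"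
  proof -
    have "((\<lambda>\<nu>. cmod (\<nu> - \<mu>) * norm R) \<longlongrightarrow> cmod (\<mu> - \<mu>) * norm R) (at \<mu>)"
      by (intro tendsto_intros)
    then show ?thesis by (rule order_tendstoD) simp
  qed
  have "\<forall>\<^sub>F \<nu> in at \<mu>. norm (resolvent A \<nu> - R) \<le> cmod (\<nu> - \<mu>) * (2 * norm R * norm R)"
    using near
  proof eventually_elim
    case (elim \<nu>)
    then have \<nu>: "\<nu> \<notin> spectrum A"
      by (intro resolvent_perturbation[OF A \<mu>]) (simp add: R_def)
    have le: "norm (resolvent A \<nu> - R) \<le> cmod (\<nu> - \<mu>) * (norm (resolvent A \<nu>) * norm R)"
    proof -
      have "norm (resolvent A \<nu> - R) \<le> cmod (\<nu> - \<mu>) * norm (resolvent A \<nu> o\<^sub>L R)"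
        unfolding R_def resolvent_difference[OF A \<mu> \<nu>] norm_minus_cancel
        by (rule norm_scalar_op_compose_le)
      also have "\<dots> \<le> cmod (\<nu> - \<mu>) * (norm (resolvent A \<nu>) * norm R)"
        by (intro mult_left_mono norm_blinfun_compose) simp
      finally show ?thesis .
    qed
    have "norm (resolvent A \<nu>) \<le> norm (resolvent A \<nu> - R) + norm R"
      using norm_triangle_ineq[of "resolvent A \<nu> - R" R] by simp
    also have "\<dots> \<le> (cmod (\<nu> - \<mu>) * norm R) * norm (resolvent A \<nu>) + norm R"
      using le by (simp add: mult_ac)
    also have "\<dots> \<le> 1 / 2 * norm (resolvent A \<nu>) + norm R"
      using elim by (intro add_right_mono mult_right_mono) auto
    finally have "norm (resolvent A \<nu>) \<le> 2 * norm R" by simp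
    then show ?case
      by (intro order_trans[OF le] mult_left_mono mult_right_mono) auto
  qed
  moreover have "((\<lambda>\<nu>. cmod (\<nu> - \<mu>) * (2 * norm R * norm R)) \<longlongrightarrow> cmod (\<mu> - \<mu>) * (2 * norm R * norm R)) (at \<mu>)"
    by (intro tendsto_intros)
  then have "((\<lambda>\<nu>. cmod (\<nu> - \<mu>) * (2 * norm R * norm R)) \<longlongrightarrow> 0) (at \<mu>)" by simp
  ultimately have "((\<lambda>\<nu>. resolvent A \<nu> - R) \<longlongrightarrow> 0) (at \<mu>)"
    by (rule Lim_null_comparison)
  then show ?thesis unfolding R_def by (rule LIM_zero_cancel)
qed

lemma continuous_on_resolvent:
  "A \<in> bounded_operators \<Longrightarrow> continuous_on (- spectrum A) (resolvent A)"
  by (intro continuous_at_imp_continuous_on) (auto simp: isCont_def continuous_resolvent)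

primrec resolvent_power ::
    "('a :: complex_hilbert \<Rightarrow>\<^sub>L 'a) \<Rightarrow> complex \<Rightarrow> nat \<Rightarrow> 'a \<Rightarrow>\<^sub>L 'a" where
  "resolvent_power A \<mu> 0 = id_blinfun"
| "resolvent_power A \<mu> (Suc n) = resolvent A \<mu> o\<^sub>L resolvent_power A \<mu> n"

lemma continuous_resolvent_power:
  assumes A: "A \<in> bounded_operators" and \<mu>: "\<mu> \<notin> spectrum A"
  shows "((\<lambda>\<nu>. resolvent_power A \<nu> n) \<longlongrightarrow> resolvent_power A \<mu> n) (at \<mu>)"
  by (induction n) (auto intro!: tendsto_intros continuous_resolvent[OF A \<mu>])

lemma tendsto_cinner_blinfun:
  "(F \<longlongrightarrow> G) net \<Longrightarrow> ((\<lambda>z. cinner (blinfun_apply (F z) x) y) \<longlongrightarrow> cinner (G x) y) net"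
  by (intro cinner.tendsto tendsto_const blinfun.tendsto)

text \<open>
  The functions of \<open>\<nu>\<close> are scalar, and their derivatives are limits of difference quotients, computed
  from the resolvent identity and the norm continuity of the resolvent.
\<close>
lemma has_field_derivative_resolvent_power:
  assumes A: "A \<in> bounded_operators" and \<mu>: "\<mu> \<notin> spectrum A"
  shows "((\<lambda>\<nu>. cinner (resolvent_power A \<nu> n x) y) has_field_derivative
      - of_nat n * cinner (resolvent_power A \<mu> (Suc n) x) y) (at \<mu>)"
proof (induction n arbitrary: y)
  case 0
  show ?case by simp
next
  case (Suc n)
  have ev: "\<forall>\<^sub>F \<nu> in at \<mu>. \<nu> \<notin> spectrum A \<and> \<nu> \<noteq> \<mu>"
  proof (rule eventually_conj)
    show "\<forall>\<^sub>F \<nu> in at \<mu>. \<nu> \<notin> spectrum A"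
      using closed_spectrum[OF A] \<mu> eventually_at_topological
      by (metis (mono_tags) ComplD ComplI open_Compl)
  qed (simp add: eventually_at_filter)
  \<comment> \<open>\<open>R\<nu>\<^sup>n\<^sup>+\<^sup>1 - R\<mu>\<^sup>n\<^sup>+\<^sup>1 = (R\<nu> - R\<mu>) R\<nu>\<^sup>n + R\<mu> (R\<nu>\<^sup>n - R\<mu>\<^sup>n)\<close>\<close>
  define f where "f \<nu> = cinner (resolvent_power A \<nu> n x) (adjoint_op (resolvent A \<mu>) y)" for \<nu>
  have fe: "f \<nu> = cinner (resolvent A \<mu> (resolvent_power A \<nu> n x)) y" for \<nu>
    unfolding f_def by (rule cinner_adjoint[OF resolvent_bounded_operators[OF \<mu>], symmetric])
  have split: "(cinner (resolvent_power A \<nu> (Suc n) x) y - cinner (resolvent_power A \<mu> (Suc n) x) y) / (\<nu> - \<mu>)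
      = (f \<nu> - f \<mu>) / (\<nu> - \<mu>) - cinner ((resolvent A \<mu> o\<^sub>L (resolvent A \<nu> o\<^sub>L resolvent_power A \<nu> n)) x) y"
    if "\<nu> \<notin> spectrum A \<and> \<nu> \<noteq> \<mu>" for \<nu>
  proof -
    define z where "z = resolvent_power A \<nu> n x"
    have "resolvent A \<nu> z = resolvent A \<mu> z - (\<nu> - \<mu>) *\<^sub>C resolvent A \<mu> (resolvent A \<nu> z)"
      using resolvent_identity[OF A \<mu>, of \<nu> z] that by (simp add: algebra_simps)
    from arg_cong[OF this, of "\<lambda>u. cinner u y"]
    have "cinner (resolvent_power A \<nu> (Suc n) x) y
       = f \<nu> - (\<nu> - \<mu>) * cinner (resolvent A \<mu> (resolvent A \<nu> z)) y"
      by (simp add: z_def fe cinner.diff_left cinner_scaleC_left)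
    moreover have "cinner (resolvent_power A \<mu> (Suc n) x) y = f \<mu>"
      by (simp add: fe)
    ultimately show ?thesis
      using that by (simp add: z_def field_simps)
  qed
  have "(f has_field_derivative - of_nat n *
      cinner (resolvent_power A \<mu> (Suc n) x) (adjoint_op (resolvent A \<mu>) y)) (at \<mu>)"
    unfolding f_def by (rule Suc.IH)
  then have "((\<lambda>\<nu>. (f \<nu> - f \<mu>) / (\<nu> - \<mu>)) \<longlongrightarrow>
     - of_nat n * cinner (resolvent_power A \<mu> (Suc n) x) (adjoint_op (resolvent A \<mu>) y)) (at \<mu>)"
    by (simp add: has_field_derivative_iff)
  moreover have "((\<lambda>\<nu>. cinner ((resolvent A \<mu> o\<^sub>L (resolvent A \<nu> o\<^sub>L resolvent_power A \<nu> n)) x) y)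
      \<longlongrightarrow> cinner ((resolvent A \<mu> o\<^sub>L (resolvent A \<mu> o\<^sub>L resolvent_power A \<mu> n)) x) y) (at \<mu>)"
    by (intro tendsto_cinner_blinfun tendsto_intros continuous_resolvent[OF A \<mu>]
        continuous_resolvent_power[OF A \<mu>])
  ultimately have "((\<lambda>\<nu>. (f \<nu> - f \<mu>) / (\<nu> - \<mu>)
        - cinner ((resolvent A \<mu> o\<^sub>L (resolvent A \<nu> o\<^sub>L resolvent_power A \<nu> n)) x) y)
      \<longlongrightarrow> - of_nat n * cinner (resolvent_power A \<mu> (Suc n) x) (adjoint_op (resolvent A \<mu>) y)
        - cinner ((resolvent A \<mu> o\<^sub>L (resolvent A \<mu> o\<^sub>L resolvent_power A \<mu> n)) x) y) (at \<mu>)"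
    by (rule tendsto_diff)
  also have "- of_nat n * cinner (resolvent_power A \<mu> (Suc n) x) (adjoint_op (resolvent A \<mu>) y)
        - cinner ((resolvent A \<mu> o\<^sub>L (resolvent A \<mu> o\<^sub>L resolvent_power A \<mu> n)) x) y
      = - of_nat (Suc n) * cinner (resolvent_power A \<mu> (Suc (Suc n)) x) y"
    by (simp add: algebra_simps flip: cinner_adjoint[OF resolvent_bounded_operators[OF \<mu>]])
  finally show ?case
    unfolding has_field_derivative_iff
    by (rule Lim_transform_eventually) (rule eventually_mono[OF ev], rule split[symmetric])
qed

lemma holomorphic_resolvent_power:
  assumes A: "A \<in> bounded_operators"
  shows "(\<lambda>\<mu>. cinner (resolvent_power A \<mu> n x) y) holomorphic_on (- spectrum A)"
  unfolding holomorphic_on_def field_differentiable_def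
  using has_field_derivative_resolvent_power[OF A] has_field_derivative_at_within
  by (metis ComplD)

lemma holomorphic_resolvent:
  assumes A: "A \<in> bounded_operators"
  shows "(\<lambda>\<mu>. cinner (resolvent A \<mu> x) y) holomorphic_on (- spectrum A)"
  using holomorphic_resolvent_power[OF A, of 1 x y] by simp

text \<open>
  Cauchy's inequality for these derivatives bounds the growth of powers of the resolvent.
\<close>
lemma higher_deriv_resolvent:
  assumes A: "A \<in> bounded_operators" and \<mu>: "\<mu> \<notin> spectrum A"
  shows "(deriv ^^ n) (\<lambda>\<mu>. cinner (resolvent A \<mu> x) y) \<mu>
      = (-1) ^ n * fact n * cinner (resolvent_power A \<mu> (Suc n) x) y"
  using \<mu>
proof (induction n arbitrary: \<mu>)
  case (Suc n)
  have op: "open (- spectrum A)" using closed_spectrum[OF A] by blast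
  have "(deriv ^^ Suc n) (\<lambda>\<mu>. cinner (resolvent A \<mu> x) y) \<mu>
      = deriv (\<lambda>\<mu>. (-1) ^ n * fact n * cinner (resolvent_power A \<mu> (Suc n) x) y) \<mu>"
    unfolding funpow.simps(2) comp_def
    by (rule deriv_cong_ev[OF _ refl], rule eventually_nhds_in_open[OF op, THEN eventually_mono])
      (use Suc in auto)
  also have "\<dots> = (-1) ^ n * fact n * (- of_nat (Suc n) * cinner (resolvent_power A \<mu> (Suc (Suc n)) x) y)"
    by (intro DERIV_imp_deriv DERIV_cmult has_field_derivative_resolvent_power A Suc)
  finally show ?case by (simp add: algebra_simps)
qed simp

section \<open>Normal operators\<close>

text \<open>
  For the normal operator \<open>M = \<mu> - N\<close> one has \<open>\<parallel>M x\<parallel>\<^sup>2 = \<langle>x, M\<^sup>*M x\<rangle>\<close> and \<open>\<parallel>M\<^sup>* u\<parallel> = \<parallel>M u\<parallel>\<close>. Applied to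
  iterated resolvents of a vector, the inequality says that their norms form a log-convex sequence.
\<close>
lemma normal_op_norm_square_le:
  assumes N: "N \<in> bounded_operators" "normal_op N"
  shows "(norm (\<mu> *\<^sub>C x - N x))\<^sup>2
    \<le> norm x * norm (\<mu> *\<^sub>C (\<mu> *\<^sub>C x - N x) - N (\<mu> *\<^sub>C x - N x))"
proof -
  define M where "M x = \<mu> *\<^sub>C x - N x" for x
  define S where "S x = cnj \<mu> *\<^sub>C x - adjoint_op N x" for x
  have adj: "cinner (M x) y = cinner x (S y)" for x y
    by (simp add: M_def S_def cinner_simps cinner_adjoint[OF N(1)])
  have "adjoint_op N (N x) = N (adjoint_op N x)" for x
    using arg_cong[OF N(2)[unfolded normal_op_def], of "\<lambda>F. blinfun_apply F x"] by simp
  then have comm: "S (M x) = M (S x)" for x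
    by (simp add: S_def M_def blinfun.diff_right complex_vector.scale_right_diff_distrib
        bounded_operators_scaleC[OF N(1)]
        bounded_operators_scaleC[OF adjoint_op_bounded_operators[OF N(1)]] scaleC_scaleC
        algebra_simps)
  have "cinner (S u) (S u) = cinner (M u) (M u)" for u
    by (metis adj cinner_commute comm)
  then have norm_S: "norm (S u) = norm (M u)" for u
    unfolding cinner_self of_real_eq_iff by simp
  have "(norm (M x))\<^sup>2 = cmod (cinner (M x) (M x))"
    by (simp only: cinner_self norm_of_real abs_power2)
  also have "\<dots> = cmod (cinner x (S (M x)))" by (simp only: adj)
  also have "\<dots> \<le> norm x * norm (S (M x))" by (rule cmod_cinner_le)
  finally show ?thesis unfolding norm_S by (simp add: M_def)
qed

text \<open>
  The quotients of consecutive terms are nondecreasing; the form without division also covers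
  sequences that reach 0.
\<close>
lemma log_convex_sequence_growth:
  fixes a :: "nat \<Rightarrow> real"
  assumes nonneg: "\<And>n. 0 \<le> a n" and conv: "\<And>n. (a (Suc n))\<^sup>2 \<le> a n * a (Suc (Suc n))"
  shows "a 1 ^ n * a 0 \<le> a 0 ^ n * a n"
proof -
  have step: "a 1 * a n \<le> a 0 * a (Suc n)" for n
  proof (induction n)
    case (Suc n)
    show ?case
    proof (cases "a (Suc n) = 0")
      case False
      then have pos: "0 < a (Suc n)" using nonneg[of "Suc n"] by simp
      have "a 1 * (a (Suc n))\<^sup>2 \<le> a 1 * (a n * a (Suc (Suc n)))"
        by (intro mult_left_mono conv nonneg)
      also have "\<dots> \<le> a 0 * a (Suc n) * a (Suc (Suc n))"
        using mult_right_mono[OF Suc nonneg[of "Suc (Suc n)"]] by (simp add: mult.assoc)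
      finally have "(a 1 * a (Suc n)) * a (Suc n) \<le> (a 0 * a (Suc (Suc n))) * a (Suc n)"
        by (simp add: power2_eq_square mult_ac)
      with pos show ?thesis by (rule mult_right_le_imp_le[rotated])
    qed (simp add: nonneg)
  qed simp
  show ?thesis
  proof (induction n)
    case (Suc n)
    have "a 1 ^ Suc n * a 0 \<le> a 1 * (a 0 ^ n * a n)"
      using mult_left_mono[OF Suc nonneg[of 1]] by (simp add: mult.assoc)
    also have "\<dots> \<le> a 0 ^ n * (a 0 * a (Suc n))"
      using mult_left_mono[OF step[of n], of "a 0 ^ n"] nonneg[of 0] by (simp add: mult_ac)
    finally show ?case by (simp add: mult_ac)
  qed simp
qed

text \<open>
  Cauchy's inequality on a circle of radius \<open>r\<close>, applied to \<open>w \<mapsto> \<langle>(w - A)\<^sup>-\<^sup>1 x, y\<rangle>\<close> with \<open>y\<close> the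
  iterated resolvent of \<open>x\<close> itself, so that the derivative at the centre is \<open>n!\<close> times \<open>\<parallel>y\<parallel>\<^sup>2\<close> up to sign.
\<close>
lemma norm_resolvent_power_le:
  fixes A :: "'a :: complex_hilbert \<Rightarrow>\<^sub>L 'a"
  assumes A: "A \<in> bounded_operators" and r: "0 < r" "cball \<mu> r \<inter> spectrum A = {}"
  obtains B where "\<And>n. norm (resolvent_power A \<mu> (Suc n) x) * r ^ n \<le> B"
proof -
  have sub: "cball \<mu> r \<subseteq> - spectrum A" using r by auto
  have cont: "continuous_on (cball \<mu> r) (\<lambda>w. norm (resolvent A w x))"
    by (intro continuous_on_norm blinfun.continuous_on continuous_on_const
        continuous_on_subset[OF continuous_on_resolvent[OF A] sub])
  have "bdd_above ((\<lambda>w. norm (resolvent A w x)) ` cball \<mu> r)"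
    by (intro bounded_imp_bdd_above compact_imp_bounded compact_continuous_image cont) simp
  then obtain B where B: "\<And>w. w \<in> cball \<mu> r \<Longrightarrow> norm (resolvent A w x) \<le> B"
    by (auto simp: bdd_above_def simp del: mem_cball)
  have "0 \<le> B" using order_trans[OF norm_ge_zero B[of \<mu>]] r(1) by simp
  have "\<mu> \<in> cball \<mu> r" using r(1) by simp
  then have \<mu>: "\<mu> \<notin> spectrum A" using r(2) by blast
  show ?thesis
  proof (rule that)
    fix n
    define y where "y = resolvent_power A \<mu> (Suc n) x"
    have hol: "(\<lambda>w. cinner (resolvent A w x) y) holomorphic_on cball \<mu> r"
      by (rule holomorphic_on_subset[OF holomorphic_resolvent[OF A] sub])
    have "cmod ((deriv ^^ n) (\<lambda>w. cinner (resolvent A w x) y) \<mu>) \<le> fact n * (B * norm y) / r ^ n"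
    proof (rule Cauchy_inequality)
      show "(\<lambda>w. cinner (resolvent A w x) y) holomorphic_on ball \<mu> r"
        by (rule holomorphic_on_subset[OF hol]) auto
      show "continuous_on (cball \<mu> r) (\<lambda>w. cinner (resolvent A w x) y)"
        by (rule holomorphic_on_imp_continuous_on[OF hol])
      show "cmod (cinner (resolvent A w x) y) \<le> B * norm y" if "cmod (\<mu> - w) = r" for w
        by (rule order_trans[OF cmod_cinner_le mult_right_mono[OF B]])
          (use that in \<open>simp_all add: dist_norm\<close>)
    qed (rule r)
    moreover have "cmod ((deriv ^^ n) (\<lambda>w. cinner (resolvent A w x) y) \<mu>) = fact n * (norm y)\<^sup>2"
      unfolding higher_deriv_resolvent[OF A \<mu>] y_def[symmetric]
      by (simp add: norm_mult norm_power cinner_self)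
    ultimately have "fact n * (norm y)\<^sup>2 \<le> fact n * (B * norm y / r ^ n)" by simp
    then have "(norm y)\<^sup>2 \<le> B * norm y / r ^ n"
      by (rule mult_left_le_imp_le) (rule fact_gt_zero)
    then have "norm y * (norm y * r ^ n) \<le> norm y * B"
      using r by (simp add: power2_eq_square field_simps)
    then show "norm y * r ^ n \<le> B"
      using \<open>0 \<le> B\<close> by (cases "norm y = 0") auto
  qed
qed

text \<open>
  The norms \<open>a n\<close> of the iterated resolvents at \<open>\<mu>\<close> of the vector \<open>y = (\<mu> - N) x\<close> grow at least like
  \<open>(a 1 / a 0)\<^sup>n\<close> by log-convexity, and at most like \<open>r\<^sup>-\<^sup>n\<close> for every \<open>r < d\<close> by Cauchy's inequality.
  Therefore \<open>d \<parallel>x\<parallel> = d (a 1) \<le> a 0 = \<parallel>y\<parallel>\<close>.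
\<close>
lemma normal_op_lower_bound:
  fixes N :: "'a :: complex_hilbert \<Rightarrow>\<^sub>L 'a"
  assumes N: "N \<in> bounded_operators" "normal_op N"
    and d: "0 < d" "ball \<mu> d \<inter> spectrum N = {}"
  shows "d * norm x \<le> norm (\<mu> *\<^sub>C x - N x)"
proof -
  have "\<mu> \<in> ball \<mu> d" using d(1) by simp
  then have \<mu>: "\<mu> \<notin> spectrum N" using d(2) by blast
  define y where "y = \<mu> *\<^sub>C x - N x"
  define a where "a n = norm (resolvent_power N \<mu> n y)" for n
  have a0: "a 0 = norm y" and a1: "a 1 = norm x"
    by (simp_all add: a_def y_def resolvent_left[OF \<mu>])
  have growth: "a 1 ^ n * a 0 \<le> a 0 ^ n * a n" for n
  proof (rule log_convex_sequence_growth)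
    show "(a (Suc n))\<^sup>2 \<le> a n * a (Suc (Suc n))" for n
      using normal_op_norm_square_le[OF N, of \<mu> "resolvent_power N \<mu> (Suc (Suc n)) y"]
      by (simp add: a_def resolvent_right[OF \<mu>] mult.commute)
  qed (simp add: a_def)
  have "r * a 1 \<le> a 0" if r: "0 < r" "r < d" for r
  proof (rule ccontr)
    assume neg: "\<not> r * a 1 \<le> a 0"
    have "cball \<mu> r \<subseteq> ball \<mu> d" using r by (simp add: cball_subset_ball_iff)
    with d have "cball \<mu> r \<inter> spectrum N = {}" by blast
    then obtain B where B: "\<And>n. a (Suc n) * r ^ n \<le> B"
      unfolding a_def using norm_resolvent_power_le[OF N(1) r(1), of \<mu> y] by metis
    have "x \<noteq> 0" using neg r a0 a1 by auto
    have "y \<noteq> 0"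
    proof
      assume "y = 0"
      then have "resolvent N \<mu> 0 = x" using resolvent_left[OF \<mu>, of x] by (simp add: y_def)
      with \<open>x \<noteq> 0\<close> show False by (simp add: blinfun.zero_right)
    qed
    then have pos: "0 < a 0" "0 < a 1" unfolding a0 a1 using \<open>x \<noteq> 0\<close> by simp_all
    have "(r * a 1 / a 0) ^ n \<le> B / a 1" for n
    proof -
      have "(r * a 1) ^ n * (a 1 * a 0) = r ^ n * (a 1 ^ Suc n * a 0)"
        by (simp add: power_mult_distrib mult_ac)
      also have "\<dots> \<le> r ^ n * (a 0 ^ Suc n * a (Suc n))"
        using r by (intro mult_left_mono growth) simp
      also have "\<dots> = a 0 ^ Suc n * (a (Suc n) * r ^ n)" by (simp add: mult_ac)
      also have "\<dots> \<le> a 0 ^ Suc n * B" using pos by (intro mult_left_mono B) simp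
      finally have "((r * a 1) ^ n * a 1) * a 0 \<le> (a 0 ^ n * B) * a 0" by (simp add: mult_ac)
      then have "(r * a 1) ^ n * a 1 \<le> a 0 ^ n * B" using pos by simp
      then show ?thesis using pos by (simp add: power_divide field_simps)
    qed
    moreover have "1 < r * a 1 / a 0" using neg pos by (simp add: field_simps)
    then obtain n where "B / a 1 < (r * a 1 / a 0) ^ n" using real_arch_pow by blast
    ultimately show False by (meson not_le)
  qed
  then have *: "r * norm x \<le> norm y" if "0 < r" "r < d" for r
    using that unfolding a0 a1 by blast
  show ?thesis
  proof (rule ccontr)
    assume "\<not> ?thesis"
    then have less: "norm y < d * norm x" by (simp add: y_def)
    then have x: "0 < norm x" using d(1) norm_ge_zero[of y] by (cases "x = 0") auto
    then have "norm y / norm x < d" using less by (simp add: field_simps)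
    then obtain r where r: "norm y / norm x < r" "r < d" using dense by blast
    have "0 \<le> norm y / norm x" by simp
    then have "0 < r" using r(1) by linarith
    then have "r * norm x \<le> norm y" using * r by blast
    then show False using r(1) x by (simp add: field_simps)
  qed
qed

text \<open>
  Suppose that \<open>w = \<langle>N e, e\<rangle>\<close> is outside the spectrum, with nearest point \<open>a\<close> and unit direction \<open>u\<close>
  from \<open>a\<close> to \<open>w\<close>. By convexity, the open disc of radius \<open>t\<close> about \<open>a + t u\<close> avoids the spectrum for
  every \<open>t > 0\<close>. Expanding \<open>\<parallel>(a + t u - N) e\<parallel>\<^sup>2 \<ge> t\<^sup>2\<close> yields \<open>2 t |w - a| \<le> \<parallel>(a - N) e\<parallel>\<^sup>2\<close>, which
  fails for large \<open>t\<close>.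
\<close>
lemma numerical_value_in_convex_spectrum:
  fixes N :: "'a :: complex_hilbert \<Rightarrow>\<^sub>L 'a"
  assumes N: "N \<in> bounded_operators" "normal_op N"
    and conv: "convex (spectrum N)" and ne: "spectrum N \<noteq> {}" and e: "norm e = 1"
  shows "cinner (N e) e \<in> spectrum N"
proof (rule ccontr)
  define w where "w = cinner (N e) e"
  define a where "a = closest_point (spectrum N) w"
  define u where "u = sgn (w - a)"
  assume "cinner (N e) e \<notin> spectrum N"
  then have w: "w \<notin> spectrum N" by (simp add: w_def)
  note cl = closed_spectrum[OF N(1)]
  have "a \<in> spectrum N" unfolding a_def by (rule closest_point_in_set[OF cl ne])
  then have wa: "w - a \<noteq> 0" using w by auto
  then have u1: "cmod u = 1" by (simp add: u_def norm_sgn)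
  define b where "b = (norm (a *\<^sub>C e - N e))\<^sup>2"
  have "2 * t * cmod (w - a) \<le> b" if t: "0 < t" for t :: real
  proof -
    have "ball (a + of_real t * u) t \<inter> spectrum N = {}"
    proof -
      have "t \<le> cmod (a + of_real t * u - l)" if l: "l \<in> spectrum N" for l
      proof -
        have "inner (w - a) (l - a) \<le> 0"
          unfolding a_def by (rule closest_point_dot[OF conv cl l])
        then have ul: "inner u (l - a) \<le> 0"
          unfolding u_def sgn_div_norm inner_scaleR_left
          by (intro mult_nonneg_nonpos) auto
        have sq: "(norm (p - q))\<^sup>2 = (norm p)\<^sup>2 - 2 * inner p q + (norm q)\<^sup>2" for p q :: complex
          by (simp add: power2_norm_eq_inner inner_diff inner_commute)
        have hn: "norm (t *\<^sub>R u) = t" using t u1 by simp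
        have "t\<^sup>2 \<le> (norm (t *\<^sub>R u))\<^sup>2 - 2 * t * inner u (l - a) + (norm (l - a))\<^sup>2"
          using t ul u1 mult_nonneg_nonpos[of "2 * t" "inner u (l - a)"]
            zero_le_power2[of "norm (l - a)"]
          unfolding hn by linarith
        also have "\<dots> = (norm (t *\<^sub>R u - (l - a)))\<^sup>2"
          using sq[of "t *\<^sub>R u" "l - a"] by simp
        finally have "t\<^sup>2 \<le> (cmod (a + of_real t * u - l))\<^sup>2"
          by (simp add: scaleR_conv_of_real algebra_simps)
        then show ?thesis by (rule power2_le_imp_le) simp
      qed
      then have "l \<notin> ball (a + of_real t * u) t" if "l \<in> spectrum N" for l
        unfolding mem_ball dist_norm not_less using that by blast
      then show ?thesis by blast
    qed
    from normal_op_lower_bound[OF N t this, of e]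
    have "t \<le> norm ((a + of_real t * u) *\<^sub>C e - N e)" by (simp add: e)
    also have "(a + of_real t * u) *\<^sub>C e - N e = (a *\<^sub>C e - N e) + (of_real t * u) *\<^sub>C e"
      by (simp add: scaleC_add_left)
    finally have "t\<^sup>2 \<le> (norm ((a *\<^sub>C e - N e) + (of_real t * u) *\<^sub>C e))\<^sup>2"
      using t by (intro power_mono) auto
    also have "\<dots> = b + 2 * Re (cinner (a *\<^sub>C e - N e) ((of_real t * u) *\<^sub>C e)) + t\<^sup>2"
      unfolding norm_add_square using t by (simp add: b_def norm_scaleC norm_mult u1 e)
    also have "cinner (a *\<^sub>C e - N e) ((of_real t * u) *\<^sub>C e) = - of_real (t * cmod (w - a))"
    proof -
      have "cnj u * (w - a) = of_real (cmod (w - a))"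
        using wa complex_norm_square[of "w - a"]
        by (simp add: u_def sgn_eq power2_eq_square field_simps)
      moreover have "cinner (a *\<^sub>C e - N e) ((of_real t * u) *\<^sub>C e)
          = - (of_real t * (cnj u * (w - a)))"
        by (simp add: cinner_simps cinner_self e flip: w_def) (simp add: algebra_simps)
      ultimately show ?thesis by simp
    qed
    finally show ?thesis by (simp add: mult_ac)
  qed
  from this[of "(b + 1) / (2 * cmod (w - a))"] show False
    using wa by (auto simp: b_def add_nonneg_pos)
qed

section \<open>Riesz projections\<close>

lemma isolated_disc:
  assumes "z isolated_in (S :: complex set)"
  shows "\<exists>r>0. cball z r \<inter> S = {z}"
proof -
  obtain T where "open T" "T \<inter> S = {z}" using assms by (auto simp: isolated_in_def)
  then obtain r where "0 < r" "cball z r \<subseteq> T"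
    by (metis Int_iff insertI1 open_contains_cball)
  with \<open>T \<inter> S = {z}\<close> show ?thesis by (intro exI[of _ r]) auto
qed

lemma circle_outside_spectrum:
  assumes "0 < r" "cball z r \<inter> spectrum A = {z}" "w \<in> path_image (circlepath z r)"
  shows "w \<notin> spectrum A"
proof
  assume "w \<in> spectrum A"
  moreover have "dist z w = r" using assms(1,3) by simp
  ultimately have "w \<in> cball z r \<inter> spectrum A" by simp
  then show False using assms \<open>dist z w = r\<close> by auto
qed

lemma continuous_on_scalar_op: "continuous_on S (scalar_op :: complex \<Rightarrow> 'a :: complex_hilbert \<Rightarrow>\<^sub>L 'a)"
proof (rule linear_continuous_on)
  show "bounded_linear (scalar_op :: complex \<Rightarrow> 'a \<Rightarrow>\<^sub>L 'a)"
  proof (rule bounded_linear_intro[where K = 1])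
    fix c :: complex
    show "norm (scalar_op c :: 'a \<Rightarrow>\<^sub>L 'a) \<le> norm c * 1"
      by (rule norm_blinfun_bound) (simp_all add: norm_scaleC)
  qed (simp_all add: blinfun_eqI blinfun.add_left blinfun.scaleR_left scaleC_add_left
      scaleR_conv_of_real scaleC_scaleC scaleC_of_real[symmetric])
qed

text \<open>
  The integral in the operator norm commutes with the bounded functional \<open>B \<mapsto> \<langle>B x, y\<rangle>\<close>. The radius is
  the one selected in the definition of the projection.
\<close>
lemma riesz_projection_weak:
  fixes A :: "'a :: complex_hilbert \<Rightarrow>\<^sub>L 'a"
  assumes A: "A \<in> bounded_operators" and z: "z isolated_in spectrum A"
  obtains r where "0 < r" "cball z r \<inter> spectrum A = {z}"
    "\<And>x y. cinner (riesz_projection A z x) y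
      = 1 / (2 * of_real pi * \<i>) * contour_integral (circlepath z r) (\<lambda>w. cinner (resolvent A w x) y)"
proof -
  define r where "r = (SOME r. r > 0 \<and> cball z r \<inter> spectrum A = {z})"
  have r: "0 < r" "cball z r \<inter> spectrum A = {z}"
    using someI_ex[OF isolated_disc[OF z]] by (simp_all add: r_def)
  have circ: "path_image (circlepath z r) \<subseteq> - spectrum A"
    using circle_outside_spectrum[OF r] by blast
  show ?thesis
  proof (rule that[OF r])
    fix x y :: 'a
    define g where "g = circlepath z r"
    define F where "F t = scalar_op (vector_derivative g (at t within {0..1})) o\<^sub>L resolvent A (g t)" for t
    have "continuous_on {0..1} (\<lambda>t. scalar_op (2 * pi * \<i> * r * exp (2 * of_real pi * \<i> * of_real t))
        o\<^sub>L resolvent A (g t))"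
    proof (rule bounded_bilinear.continuous_on[OF bounded_bilinear_blinfun_compose])
      show "continuous_on {0..1} (\<lambda>t. resolvent A (g t))"
      proof (rule continuous_on_compose2[OF continuous_on_resolvent[OF A]])
        show "continuous_on {0..1} g"
          using path_circlepath[of z r] by (simp add: path_def g_def)
        show "g ` {0..1} \<subseteq> - spectrum A" using circ by (simp add: path_image_def g_def)
      qed
    qed (intro continuous_on_compose2[OF continuous_on_scalar_op[of UNIV]] continuous_intros subset_UNIV)
    then have "continuous_on {0..1} F"
      by (rule continuous_on_eq) (simp add: F_def g_def vector_derivative_circlepath01)
    then have int: "F integrable_on {0..1}" by (rule integrable_continuous_real)
    have bl: "bounded_linear (\<lambda>B. cinner (blinfun_apply B x) y)"
      by (rule bounded_linear_compose[OF cinner.bounded_linear_left blinfun.bounded_linear_left])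
    have "riesz_projection A z
        = scalar_op (1 / (2 * of_real pi * \<i>)) o\<^sub>L integral {0..1} F"
      by (simp add: riesz_projection_def Let_def op_contour_integral_def F_def[abs_def] g_def
          flip: r_def)
    then have "cinner (riesz_projection A z x) y
        = 1 / (2 * of_real pi * \<i>) * cinner (integral {0..1} F x) y"
      by (simp add: cinner_scaleC_left)
    also have "cinner (integral {0..1} F x) y = integral {0..1} (\<lambda>t. cinner (F t x) y)"
      using integral_linear[OF int bl] by (simp add: comp_def)
    also have "\<dots> = contour_integral g (\<lambda>w. cinner (resolvent A w x) y)"
      unfolding contour_integral_integral
      by (intro integral_cong)
        (simp add: F_def cinner_scaleC_left g_def vector_derivative_circlepath01
          vector_derivative_circlepath mult.commute)
    finally show "cinner (riesz_projection A z x) y = 1 / (2 * of_real pi * \<i>)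
        * contour_integral (circlepath z r) (\<lambda>w. cinner (resolvent A w x) y)"
      by (simp add: g_def)
  qed
qed

context
  fixes A :: "'a :: complex_hilbert \<Rightarrow>\<^sub>L 'a" and z :: complex
  assumes A: "A \<in> bounded_operators" and z: "z isolated_in spectrum A"
begin

lemma resolvent_contour_integrable:
  assumes "0 < r" "cball z r \<inter> spectrum A = {z}"
  shows "(\<lambda>w. cinner (resolvent A w x) y) contour_integrable_on circlepath z r"
proof (rule contour_integrable_continuous_circlepath)
  have "path_image (circlepath z r) \<subseteq> - spectrum A"
    using circle_outside_spectrum[OF assms] by blast
  then show "continuous_on (path_image (circlepath z r)) (\<lambda>w. cinner (resolvent A w x) y)"
    by (rule continuous_on_subset[OF holomorphic_on_imp_continuous_on[OF holomorphic_resolvent[OF A]]])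
qed

lemma riesz_projection_bounded_operators: "riesz_projection A z \<in> bounded_operators"
  unfolding in_bounded_operators
proof (intro allI cinner_ext_left)
  fix c x y
  obtain r where r: "0 < r" "cball z r \<inter> spectrum A = {z}"
    and weak: "\<And>x y. cinner (riesz_projection A z x) y
      = 1 / (2 * of_real pi * \<i>) * contour_integral (circlepath z r) (\<lambda>w. cinner (resolvent A w x) y)"
    using riesz_projection_weak[OF A z] by metis
  have "contour_integral (circlepath z r) (\<lambda>w. cinner (resolvent A w (c *\<^sub>C x)) y)
      = contour_integral (circlepath z r) (\<lambda>w. c * cinner (resolvent A w x) y)"
  proof (rule contour_integral_eq)
    fix w assume "w \<in> path_image (circlepath z r)"
    then have "w \<notin> spectrum A" by (rule circle_outside_spectrum[OF r])
    then show "cinner (resolvent A w (c *\<^sub>C x)) y = c * cinner (resolvent A w x) y"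
      by (simp add: bounded_operators_scaleC[OF resolvent_bounded_operators] cinner_scaleC_left)
  qed
  then show "cinner (riesz_projection A z (c *\<^sub>C x)) y = cinner (c *\<^sub>C riesz_projection A z x) y"
    by (simp add: cinner_scaleC_left weak contour_integral_lmul[OF resolvent_contour_integrable[OF r]])
qed

lemma riesz_projection_commute: "A (riesz_projection A z x) = riesz_projection A z (A x)"
proof (rule cinner_ext_left)
  fix y
  obtain r where r: "0 < r" "cball z r \<inter> spectrum A = {z}"
    and weak: "\<And>x y. cinner (riesz_projection A z x) y
      = 1 / (2 * of_real pi * \<i>) * contour_integral (circlepath z r) (\<lambda>w. cinner (resolvent A w x) y)"
    using riesz_projection_weak[OF A z] by metis
  have "contour_integral (circlepath z r) (\<lambda>w. cinner (resolvent A w x) (adjoint_op A y))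
      = contour_integral (circlepath z r) (\<lambda>w. cinner (resolvent A w (A x)) y)"
  proof (rule contour_integral_eq)
    fix w assume "w \<in> path_image (circlepath z r)"
    then have "w \<notin> spectrum A" by (rule circle_outside_spectrum[OF r])
    then show "cinner (resolvent A w x) (adjoint_op A y) = cinner (resolvent A w (A x)) y"
      by (simp add: resolvent_commute[OF A] flip: cinner_adjoint[OF A])
  qed
  then show "cinner (A (riesz_projection A z x)) y = cinner (riesz_projection A z (A x)) y"
    by (simp add: cinner_adjoint[OF A] weak)
qed

text \<open>
  On an eigenvector for \<open>m\<close> the resolvent is multiplication by \<open>1 / (w - m)\<close>. Since \<open>m \<noteq> z\<close> belongs to
  the spectrum, it is outside the closed disc, and the integral is 0 by Cauchy's theorem.
\<close>
lemma riesz_projection_other_eigenvector: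
  assumes x: "A x = m *\<^sub>C x" and m: "m \<noteq> z"
  shows "riesz_projection A z x = 0"
proof (cases "x = 0")
  case False
  obtain r where r: "0 < r" "cball z r \<inter> spectrum A = {z}"
    and weak: "\<And>x y. cinner (riesz_projection A z x) y
      = 1 / (2 * of_real pi * \<i>) * contour_integral (circlepath z r) (\<lambda>w. cinner (resolvent A w x) y)"
    using riesz_projection_weak[OF A z] by metis
  have "m \<in> spectrum A"
  proof (rule ccontr)
    assume "m \<notin> spectrum A"
    from resolvent_left[OF this, of x] x False show False by (simp add: blinfun.zero_right)
  qed
  with r m have far: "r < dist z m" by (metis IntI insertE empty_iff mem_cball not_le)
  show ?thesis
  proof (rule cinner_ext_left)
    fix y
    have "contour_integral (circlepath z r) (\<lambda>w. cinner (resolvent A w x) y)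
        = contour_integral (circlepath z r) (\<lambda>w. cinner x y / (w - m))"
    proof (rule contour_integral_eq)
      fix w assume w: "w \<in> path_image (circlepath z r)"
      then have "w \<notin> spectrum A" by (rule circle_outside_spectrum[OF r])
      then have "x = (w - m) *\<^sub>C resolvent A w x"
        using resolvent_left[of w A x] x
        by (metis bounded_operators_scaleC complex_vector.scale_left_diff_distrib
            resolvent_bounded_operators)
      then have "cinner x y = (w - m) * cinner (resolvent A w x) y"
        by (metis cinner_scaleC_left)
      moreover have "w \<noteq> m" using w far r by (auto simp: dist_norm norm_minus_commute)
      ultimately show "cinner (resolvent A w x) y = cinner x y / (w - m)" by simp
    qed
    also have "\<dots> = 0"
    proof (rule contour_integral_unique, rule Cauchy_theorem_disc_simple)
      show "(\<lambda>w. cinner x y / (w - m)) holomorphic_on ball z (dist z m)"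
        by (intro holomorphic_intros) auto
      show "path_image (circlepath z r) \<subseteq> ball z (dist z m)"
        using far r by (auto simp: dist_norm norm_minus_commute)
    qed auto
    finally show "cinner (riesz_projection A z x) y = cinner 0 y"
      by (simp add: weak cinner.zero_left)
  qed
qed (simp add: blinfun.zero_right)

text \<open>
  The outer factor is integrated over the circle of half the radius. For \<open>w\<close> on it, the resolvent
  identity gives \<open>\<langle>R(w) P x, y\<rangle> = \<langle>R(w) x, y\<rangle> - k G(w)\<close>, where the Cauchy type integral \<open>G\<close> over the large
  circle is holomorphic inside it. So \<open>G\<close> contributes nothing to the integral over the small circle.
\<close>
lemma riesz_projection_idem: "riesz_projection A z (riesz_projection A z x) = riesz_projection A z x"
proof (rule cinner_ext_left)
  fix y
  define P where "P = riesz_projection A z"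
  define k where "k = 1 / (2 * complex_of_real pi * \<i>)"
  obtain r where r: "0 < r" "cball z r \<inter> spectrum A = {z}"
    and weak: "\<And>x y. cinner (P x) y
      = k * contour_integral (circlepath z r) (\<lambda>w. cinner (resolvent A w x) y)"
    unfolding P_def k_def using riesz_projection_weak[OF A z] by metis
  define f where "f w = cinner (resolvent A w x) y" for w
  have outside: "w \<notin> spectrum A" if "cmod (w - z) \<le> r" "w \<noteq> z" for w
  proof
    assume "w \<in> spectrum A"
    then have "w \<in> cball z r \<inter> spectrum A" using that by (simp add: dist_norm norm_minus_commute)
    then show False using r that by auto
  qed
  \<comment> \<open>A smaller circle keeps the two variables of integration apart.\<close>
  have weak': "cinner (P x) y
      = k * contour_integral (circlepath z (r / 2)) (\<lambda>w. cinner (resolvent A w x) y)" for x y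
  proof -
    define U where "U = - (spectrum A - ball z r)"
    have "contour_integral (circlepath z r) (\<lambda>w. cinner (resolvent A w x) y)
        = contour_integral (circlepath z (r / 2)) (\<lambda>w. cinner (resolvent A w x) y)"
    proof (rule contour_integral_circlepath_eq(3))
      show "open U" unfolding U_def by (intro open_Compl closed_Diff closed_spectrum[OF A]) auto
      show "(\<lambda>w. cinner (resolvent A w x) y) holomorphic_on U - {z}"
        by (rule holomorphic_on_subset[OF holomorphic_resolvent[OF A]])
          (use r(2) ball_subset_cball[of z r] in \<open>unfold U_def, blast\<close>)
      have "z \<in> ball z r" using r(1) by simp
      moreover have "w = z" if "w \<in> cball z r" "w \<in> spectrum A" for w
        using r(2) that by blast
      ultimately show "cball z r \<subseteq> U" unfolding U_def by blast
    qed (use r in auto)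
    then show ?thesis by (simp add: weak)
  qed
  define G where "G w = contour_integral (circlepath z r) (\<lambda>v. f v / (v - w) ^ 1)" for w
  have contf: "continuous_on (path_image (circlepath z r)) f"
    unfolding f_def
    by (rule continuous_on_subset[OF holomorphic_on_imp_continuous_on[OF holomorphic_resolvent[OF A]]])
      (use circle_outside_spectrum[OF r] in blast)
  have G: "((\<lambda>v. f v / (v - w) ^ 1) has_contour_integral G w) (circlepath z r)" if "w \<in> ball z r" for w
    unfolding G_def
    by (intro has_contour_integral_integral contour_integrable_continuous_circlepath
        continuous_intros contf) (use that in \<open>auto simp: dist_norm norm_minus_commute\<close>)
  have holG: "G holomorphic_on ball z r"
    unfolding holomorphic_on_def field_differentiable_def
    using Cauchy_next_derivative_circlepath(2)[OF contf G one_neq_zero] has_field_derivative_at_within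
    by blast
  have holG0: "(G has_contour_integral 0) (circlepath z (r / 2))"
    by (rule Cauchy_theorem_disc_simple[OF holG]) (use r in auto)
  have key: "cinner (resolvent A w (P x)) y = f w - k * G w" if w: "cmod (w - z) = r / 2" for w
  proof -
    have wz: "w \<noteq> z" using w r by auto
    have wA: "w \<notin> spectrum A" using w r wz by (intro outside) auto
    have wb: "w \<in> ball z r" using w r by (simp add: dist_norm norm_minus_commute)
    note RB = resolvent_bounded_operators[OF wA]
    have "cinner (resolvent A w (P x)) y = cinner (P x) (adjoint_op (resolvent A w) y)"
      by (rule cinner_adjoint[OF RB])
    also have "\<dots> = k * contour_integral (circlepath z r)
        (\<lambda>v. cinner (resolvent A v x) (adjoint_op (resolvent A w) y))" by (rule weak)
    also have "contour_integral (circlepath z r)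
        (\<lambda>v. cinner (resolvent A v x) (adjoint_op (resolvent A w) y))
      = contour_integral (circlepath z r) (\<lambda>v. f w / (v - w) - f v / (v - w) ^ 1)"
    proof (rule contour_integral_eq)
      fix v assume "v \<in> path_image (circlepath z r)"
      then have v: "cmod (v - z) = r" using r by (auto simp: dist_norm norm_minus_commute)
      then have vA: "v \<notin> spectrum A" using r by (intro outside) auto
      have vw: "v \<noteq> w" using v w r by auto
      have "cinner (resolvent A w x - resolvent A v x) y
          = (v - w) * cinner (resolvent A w (resolvent A v x)) y"
        by (simp add: resolvent_identity[OF A wA vA] cinner_scaleC_left)
      then have "cinner (resolvent A w (resolvent A v x)) y = (f w - f v) / (v - w)"
        using vw by (simp add: f_def cinner.diff_left field_simps)
      then show "cinner (resolvent A v x) (adjoint_op (resolvent A w) y)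
          = f w / (v - w) - f v / (v - w) ^ 1"
        by (simp add: diff_divide_distrib flip: cinner_adjoint[OF RB])
    qed
    also have "\<dots> = 2 * of_real pi * \<i> * f w - G w"
    proof (intro contour_integral_unique has_contour_integral_diff G[OF wb])
      show "((\<lambda>v. f w / (v - w)) has_contour_integral 2 * of_real pi * \<i> * f w) (circlepath z r)"
        using wb by (intro Cauchy_integral_circlepath_simple[where f = "\<lambda>_. f w"])
          (auto simp: dist_norm norm_minus_commute)
    qed
    finally show ?thesis by (simp add: k_def algebra_simps)
  qed
  have "cball z (r / 2) \<subseteq> cball z r" "z \<in> cball z (r / 2)"
    using r(1) by (simp_all add: cball_subset_cball_iff)
  with r(2) have "cball z (r / 2) \<inter> spectrum A = {z}" by blast
  then have int: "f contour_integrable_on circlepath z (r / 2)"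
    unfolding f_def using r(1) by (intro resolvent_contour_integrable) simp_all
  have "contour_integral (circlepath z (r / 2)) (\<lambda>w. cinner (resolvent A w (P x)) y)
      = contour_integral (circlepath z (r / 2)) (\<lambda>w. f w - k * G w)"
    using r by (intro contour_integral_eq key) (auto simp: dist_norm norm_minus_commute)
  also have "\<dots> = contour_integral (circlepath z (r / 2)) f - k * 0"
    by (intro contour_integral_unique has_contour_integral_diff has_contour_integral_lmul holG0
        has_contour_integral_integral int)
  finally have "cinner (P (P x)) y = cinner (P x) y"
    unfolding weak'[of "P x"] weak'[of x] by (simp add: f_def[abs_def])
  then show "cinner (riesz_projection A z (riesz_projection A z x)) y
      = cinner (riesz_projection A z x) y"
    by (simp add: P_def)
qed

end

section \<open>Nilpotency from the absence of nonzero eigenvalues\<close>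

definition poly_map :: "('a \<Rightarrow> 'a) \<Rightarrow> complex poly \<Rightarrow> 'a \<Rightarrow> 'a :: complex_inner" where
  "poly_map N q x = (\<Sum>i\<le>degree q. coeff q i *\<^sub>C (N ^^ i) x)"

lemma poly_map_eq_sum:
  assumes "degree q \<le> n"
  shows "poly_map N q x = (\<Sum>i\<le>n. coeff q i *\<^sub>C (N ^^ i) x)"
  unfolding poly_map_def using assms
  by (intro sum.mono_neutral_left) (auto simp: coeff_eq_0)

locale complex_linear_map =
  fixes N :: "'a :: complex_inner \<Rightarrow> 'a"
  assumes map_add: "N (x + y) = N x + N y" and map_scale: "N (c *\<^sub>C x) = c *\<^sub>C N x"
begin

lemma map_zero: "N 0 = 0"
  using map_scale[of 0 0] by simp

lemma map_sum: "N (\<Sum>i\<in>I. f i) = (\<Sum>i\<in>I. N (f i))"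
  by (induction I rule: infinite_finite_induct) (simp_all add: map_zero map_add)

lemma poly_map_commute: "poly_map N q (N x) = N (poly_map N q x)"
  by (simp add: poly_map_def map_sum map_scale funpow_swap1)

lemma poly_map_linear_factor:
  "poly_map N ([:- c, 1:] * q) x = N (poly_map N q x) - c *\<^sub>C poly_map N q x"
proof -
  define n where "n = degree q"
  have deg: "degree ([:- c, 1:] * q) \<le> Suc n"
    using degree_mult_le[of "[:- c, 1:]" q] by (simp add: n_def)
  have coeff: "coeff ([:- c, 1:] * q) i = (case i of 0 \<Rightarrow> 0 | Suc j \<Rightarrow> coeff q j) - c * coeff q i" for i
    by (simp add: coeff_pCons split: nat.split)
  have "poly_map N ([:- c, 1:] * q) x
      = (\<Sum>i\<le>Suc n. (case i of 0 \<Rightarrow> 0 | Suc j \<Rightarrow> coeff q j) *\<^sub>C (N ^^ i) x)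
        - (\<Sum>i\<le>Suc n. c *\<^sub>C coeff q i *\<^sub>C (N ^^ i) x)"
    unfolding poly_map_eq_sum[OF deg] coeff
    by (simp only: complex_vector.scale_left_diff_distrib scaleC_scaleC sum_subtractf)
  also have "(\<Sum>i\<le>Suc n. (case i of 0 \<Rightarrow> 0 | Suc j \<Rightarrow> coeff q j) *\<^sub>C (N ^^ i) x)
      = (\<Sum>j\<le>n. coeff q j *\<^sub>C N ((N ^^ j) x))"
    by (subst sum.atMost_Suc_shift) simp
  also have "\<dots> = N (poly_map N q x)"
    by (simp add: poly_map_def n_def map_sum map_scale)
  also have "(\<Sum>i\<le>Suc n. c *\<^sub>C coeff q i *\<^sub>C (N ^^ i) x) = c *\<^sub>C poly_map N q x"
  proof -
    have "degree q \<le> Suc n" by (simp add: n_def)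
    then show ?thesis by (simp only: poly_map_eq_sum complex_vector.scale_sum_right)
  qed
  finally show ?thesis .
qed

lemma ex_annihilating_polynomial:
  assumes fin: "finite S" and orbit: "\<And>k. (N ^^ k) x \<in> complex_vector.span S"
  shows "\<exists>q. q \<noteq> 0 \<and> poly_map N q x = 0"
proof -
  define n where "n = card S"
  define f where "f i = (N ^^ i) x" for i
  have "\<exists>c. (\<exists>i\<le>n. c i \<noteq> 0) \<and> (\<Sum>i\<le>n. c i *\<^sub>C f i) = 0"
  proof (cases "inj_on f {..n}")
    case True
    have "complex_vector.dependent (f ` {..n})"
    proof (rule ccontr)
      assume "\<not> ?thesis"
      then have "card (f ` {..n}) \<le> card S"
        using complex_vector.independent_span_bound[OF fin] orbit by (auto simp: f_def)
      then show False using card_image[OF True] by (simp add: n_def)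
    qed
    then obtain u where u: "\<exists>v\<in>f ` {..n}. u v \<noteq> 0" "(\<Sum>v\<in>f ` {..n}. u v *\<^sub>C v) = 0"
      by (subst (asm) complex_vector.dependent_finite) auto
    then show ?thesis
      by (intro exI[of _ "\<lambda>i. u (f i)"]) (auto simp: sum.reindex[OF True])
  next
    case False
    then obtain i j where ij: "i \<le> n" "j \<le> n" "i \<noteq> j" "f i = f j"
      by (auto simp: inj_on_def)
    \<comment> \<open>A repetition in the orbit is a linear relation between its members as well.\<close>
    define c :: "nat \<Rightarrow> complex" where "c k = (if k = i then 1 else 0) - (if k = j then 1 else 0)" for k
    have if_scale: "(if b then 1 else 0 :: complex) *\<^sub>C y = (if b then y else 0)" for b and y :: 'a
      by (simp add: scaleC_one)
    have "(\<Sum>k\<le>n. c k *\<^sub>C f k) = f i - f j"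
      using ij by (simp add: c_def complex_vector.scale_left_diff_distrib sum_subtractf if_scale)
    moreover have "c i \<noteq> 0" using ij by (simp add: c_def)
    ultimately show ?thesis using ij by (intro exI[of _ c]) auto
  qed
  then obtain c i where c: "i \<le> n" "c i \<noteq> 0" "(\<Sum>i\<le>n. c i *\<^sub>C f i) = 0" by blast
  define q where "q = Poly (map c [0..<Suc n])"
  have coeff: "coeff q j = (if j \<le> n then c j else 0)" for j
    by (auto simp: q_def coeff_Poly_eq nth_default_def simp del: upt_Suc)
  have "degree q \<le> n" by (rule degree_le) (simp add: coeff)
  then have "poly_map N q x = (\<Sum>i\<le>n. c i *\<^sub>C f i)"
    by (simp add: poly_map_eq_sum coeff f_def)
  moreover have "q \<noteq> 0" using c coeff[of i] by auto
  ultimately show ?thesis using c(3) by auto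
qed

text \<open>
  The orbit of \<open>x\<close> is linearly dependent, so some nonzero polynomial in \<open>N\<close> annihilates \<open>x\<close>. Its linear
  factors \<open>N - c\<close> with \<open>c \<noteq> 0\<close> are injective on \<open>V\<close> and can be cancelled; what remains is a power of \<open>N\<close>.
\<close>
lemma nilpotent_if_no_nonzero_eigenvalue:
  assumes V: "complex_vector.subspace V" and fin: "finite S" "V \<subseteq> complex_vector.span S"
    and inv: "\<And>x. x \<in> V \<Longrightarrow> N x \<in> V"
    and eig: "\<And>x c. x \<in> V \<Longrightarrow> c \<noteq> 0 \<Longrightarrow> N x = c *\<^sub>C x \<Longrightarrow> x = 0"
    and x: "x \<in> V"
  shows "\<exists>k. (N ^^ k) x = 0"
proof -
  have orbit: "(N ^^ k) x \<in> V" if "x \<in> V" for k x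
    using that by (induction k) (auto intro: inv)
  have main: "\<exists>k. (N ^^ k) x = 0" if "q \<noteq> 0" "poly_map N q x = 0" "x \<in> V" for q x
    using that
  proof (induction "degree q" arbitrary: q x)
    case 0
    then obtain c where "q = [:c:]" by (metis degree_eq_zeroE)
    with 0 have "x = 0" by (simp add: poly_map_def)
    then show ?case by (intro exI[of _ 0]) simp
  next
    case (Suc n)
    have "\<not> constant (poly q)" using Suc.hyps by (simp add: constant_degree)
    then obtain c where "poly q c = 0" using fundamental_theorem_of_algebra by blast
    then obtain q' where q': "q = [:- c, 1:] * q'" by (auto simp: poly_eq_0_iff_dvd)
    with Suc.prems have q'0: "q' \<noteq> 0" by auto
    have "degree q = degree [:- c, 1:] + degree q'"
      unfolding q' using q'0 by (intro degree_mult_eq) simp_all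
    then have deg: "n = degree q'" using Suc.hyps(2) by simp
    have "poly_map N q' x \<in> V"
      unfolding poly_map_def using V orbit[OF Suc.prems(3)]
      by (intro complex_vector.subspace_sum complex_vector.subspace_scale) auto
    moreover have *: "N (poly_map N q' x) = c *\<^sub>C poly_map N q' x"
      using Suc.prems(2) by (simp add: q' poly_map_linear_factor del: mult_pCons_left)
    ultimately have "c = 0 \<or> poly_map N q' x = 0" using eig by blast
    then show ?case
    proof
      assume "c = 0"
      then have "poly_map N q' (N x) = 0" using * by (simp add: poly_map_commute)
      from Suc.hyps(1)[OF deg q'0 this inv[OF Suc.prems(3)]] obtain k where "(N ^^ k) (N x) = 0" ..
      then show ?case by (intro exI[of _ "Suc k"]) (simp add: funpow_swap1)
    qed (rule Suc.hyps(1)[OF deg q'0 _ Suc.prems(3)])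
  qed
  have "(N ^^ k) x \<in> complex_vector.span S" for k
    using orbit[OF x] fin(2) by blast
  from ex_annihilating_polynomial[OF fin(1) this] main x show ?thesis by blast
qed

end

section \<open>Orthonormal triangular systems\<close>

abbreviation (input) "chain_span es \<equiv> complex_vector.span (fst ` set es)"

text \<open>
  An orthonormal list of vectors \<open>e\<close>, paired with numbers \<open>l\<close>, in which \<open>A\<close> is triangular with diagonal
  entries \<open>l\<close>. The list grows at its head, so that the flag of invariant subspaces consists of the spans
  of its tails.
\<close>
primrec schur_chain ::
    "('a :: complex_hilbert \<Rightarrow>\<^sub>L 'a) \<Rightarrow> ('a \<times> complex) list \<Rightarrow> bool" where
  "schur_chain A [] \<longleftrightarrow> True"
| "schur_chain A (q # es) \<longleftrightarrow> norm (fst q) = 1 \<and> (\<forall>f \<in> fst ` set es. cinner (fst q) f = 0)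
     \<and> A (fst q) - snd q *\<^sub>C fst q \<in> complex_vector.span (fst ` set es) \<and> schur_chain A es"

lemma orthogonal_to_span:
  assumes "\<And>f. f \<in> S \<Longrightarrow> cinner e f = 0" "y \<in> complex_vector.span S"
  shows "cinner e y = 0"
  using assms(2)
proof (rule complex_vector.span_induct)
  show "complex_vector.subspace {y. cinner e y = 0}"
    by (simp add: complex_vector.subspace_def cinner.zero_right cinner_add_right cinner_scaleC_right)
qed (rule assms(1))

context
  fixes A :: "'a :: complex_hilbert \<Rightarrow>\<^sub>L 'a"
  assumes A: "A \<in> bounded_operators"
begin

lemma complex_linear_shift: "complex_linear_map (\<lambda>x. A x - l *\<^sub>C x)"
  by unfold_locales (simp_all add: blinfun.add_right scaleC_add_right bounded_operators_scaleC[OF A]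
      complex_vector.scale_right_diff_distrib scaleC_scaleC mult.commute)

lemma schur_chain_invariant:
  assumes "schur_chain A es" "x \<in> chain_span es"
  shows "A x \<in> chain_span es"
  using assms(2)
proof (rule complex_vector.span_induct)
  show "complex_vector.subspace {x. A x \<in> chain_span es}"
    by (auto simp: complex_vector.subspace_def blinfun.zero_right blinfun.add_right
        bounded_operators_scaleC[OF A] complex_vector.span_zero complex_vector.span_add
        complex_vector.span_scale)
  fix f assume "f \<in> fst ` set es"
  then show "A f \<in> chain_span es"
    using assms(1)
  proof (induction es)
    case (Cons q es)
    have mono: "chain_span es \<subseteq> chain_span (q # es)"
      by (rule complex_vector.span_mono) auto
    show ?case
    proof (cases "f = fst q")
      case True
      have "A f - snd q *\<^sub>C f \<in> chain_span (q # es)" "f \<in> chain_span (q # es)"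
        using Cons.prems mono True by (auto intro: complex_vector.span_base)
      then have "(A f - snd q *\<^sub>C f) + snd q *\<^sub>C f \<in> chain_span (q # es)"
        by (intro complex_vector.span_add complex_vector.span_scale)
      then show ?thesis by simp
    next
      case False
      then show ?thesis using Cons mono by auto
    qed
  qed simp
qed

lemma schur_chain_shift_invariant:
  assumes "schur_chain A es" "x \<in> chain_span es"
  shows "A x - l *\<^sub>C x \<in> chain_span es"
  using assms schur_chain_invariant
  by (intro complex_vector.span_diff complex_vector.span_scale) auto

text \<open>
  The coefficient of \<open>x\<close> at the head is multiplied by the nonzero number \<open>m - l\<close> when \<open>A - l\<close> is
  applied, hence vanishes, and \<open>x\<close> lies in the span of the tail.
\<close>
lemma schur_chain_eigenvector:
  assumes "schur_chain A es" "l \<notin> snd ` set es" "x \<in> chain_span es" "A x = l *\<^sub>C x"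
  shows "x = 0"
  using assms
proof (induction es arbitrary: x)
  case (Cons q es)
  define e m where "e = fst q" "m = snd q"
  obtain k where y: "x - k *\<^sub>C e \<in> chain_span es"
    using Cons.prems(3) by (auto simp: complex_vector.span_insert e_m_def)
  define y where "y = x - k *\<^sub>C e"
  have x: "x = y + k *\<^sub>C e" by (simp add: y_def)
  have "A y - l *\<^sub>C y + k *\<^sub>C (A e - m *\<^sub>C e) + (k * (m - l)) *\<^sub>C e = A x - l *\<^sub>C x"
    unfolding x by (simp add: blinfun.add_right bounded_operators_scaleC[OF A] scaleC_scaleC
        complex_vector.scale_right_diff_distrib complex_vector.scale_left_diff_distrib
        scaleC_add_right algebra_simps)
  then have eq: "(k * (m - l)) *\<^sub>C e = - (A y - l *\<^sub>C y + k *\<^sub>C (A e - m *\<^sub>C e))"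
    using Cons.prems(4) by (metis add.commute eq_neg_iff_add_eq_0 right_minus_eq)
  have "A y - l *\<^sub>C y \<in> chain_span es"
    using Cons.prems(1) y by (intro schur_chain_shift_invariant) (auto simp: y_def)
  moreover have "A e - m *\<^sub>C e \<in> chain_span es" using Cons.prems(1) by (simp add: e_m_def)
  ultimately have "(k * (m - l)) *\<^sub>C e \<in> chain_span es"
    unfolding eq by (intro complex_vector.span_neg complex_vector.span_add complex_vector.span_scale)
  then have "cinner e ((k * (m - l)) *\<^sub>C e) = 0"
    by (rule orthogonal_to_span[rotated]) (use Cons.prems(1) in \<open>auto simp: e_m_def\<close>)
  moreover have "cinner e e = 1" using Cons.prems(1) by (simp add: cinner_self e_m_def)
  moreover have "m \<noteq> l" using Cons.prems(2) by (auto simp: e_m_def)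
  ultimately have "k = 0" by (simp add: cinner_scaleC_right)
  then show ?case using Cons y by simp
qed simp

lemma schur_chain_facts:
  assumes "schur_chain A es"
  shows schur_chain_norm: "q \<in> set es \<Longrightarrow> norm (fst q) = 1"
    and schur_chain_diagonal: "q \<in> set es \<Longrightarrow> cinner (A (fst q)) (fst q) = snd q"
    and schur_chain_orthogonal: "q \<in> set es \<Longrightarrow> q' \<in> set es \<Longrightarrow> q \<noteq> q' \<Longrightarrow> cinner (fst q) (fst q') = 0"
    and schur_chain_distinct: "distinct es"
proof -
  have "(\<forall>q \<in> set es. norm (fst q) = 1 \<and> cinner (A (fst q)) (fst q) = snd q) \<and>
     (\<forall>q \<in> set es. \<forall>q' \<in> set es. q \<noteq> q' \<longrightarrow> cinner (fst q) (fst q') = 0) \<and> distinct es"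
    using assms
  proof (induction es)
    case (Cons q es)
    define e m where "e = fst q" "m = snd q"
    have e: "norm e = 1" "\<And>f. f \<in> fst ` set es \<Longrightarrow> cinner e f = 0"
      "A e - m *\<^sub>C e \<in> chain_span es" using Cons.prems by (auto simp: e_m_def)
    have "cinner e (A e - m *\<^sub>C e) = 0" by (rule orthogonal_to_span[OF e(2,3)])
    then have "cinner (A e - m *\<^sub>C e) e = 0" by (simp add: cinner_zero_sym)
    then have diag: "cinner (A e) e = m" using e(1) by (simp add: cinner_simps cinner_self)
    have "q \<notin> set es"
    proof
      assume "q \<in> set es"
      then have "cinner e e = 0" using e(2)[of e] by (auto simp: e_m_def)
      then show False using e(1) by (simp add: cinner_self)
    qed
    then show ?case using Cons e diag by (auto simp: e_m_def cinner_zero_sym[of _ "fst q"])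
  qed simp
  then show "q \<in> set es \<Longrightarrow> norm (fst q) = 1" "q \<in> set es \<Longrightarrow> cinner (A (fst q)) (fst q) = snd q"
    "q \<in> set es \<Longrightarrow> q' \<in> set es \<Longrightarrow> q \<noteq> q' \<Longrightarrow> cinner (fst q) (fst q') = 0" "distinct es"
    by blast+
qed

lemma schur_chain_projection:
  assumes "schur_chain A es"
  shows "\<exists>y \<in> chain_span es. \<forall>f \<in> fst ` set es. cinner (u - y) f = 0"
  using assms
proof (induction es)
  case (Cons q es)
  define e where "e = fst q"
  obtain y where y: "y \<in> chain_span es" "\<forall>f \<in> fst ` set es. cinner (u - y) f = 0"
    using Cons by auto
  have e: "norm e = 1" "\<And>f. f \<in> fst ` set es \<Longrightarrow> cinner e f = 0"
    using Cons.prems by (auto simp: e_def)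
  have "cinner y e = 0"
    using orthogonal_to_span[OF e(2) y(1)] by (simp add: cinner_zero_sym)
  then have "cinner (u - (y + cinner u e *\<^sub>C e)) e = 0"
    using e(1) by (simp add: cinner_simps cinner_self)
  moreover have "cinner (u - (y + cinner u e *\<^sub>C e)) f = 0" if "f \<in> fst ` set es" for f
  proof -
    have "cinner (u - (y + cinner u e *\<^sub>C e)) f = cinner (u - y) f - cinner u e * cinner e f"
      by (simp add: cinner_simps)
    then show ?thesis using that y(2) e(2) by simp
  qed
  ultimately have "\<forall>f \<in> fst ` set (q # es). cinner (u - (y + cinner u e *\<^sub>C e)) f = 0"
    by (simp add: e_def)
  moreover have "y + cinner u e *\<^sub>C e \<in> chain_span (q # es)"
  proof (intro complex_vector.span_add complex_vector.span_scale)
    show "y \<in> chain_span (q # es)" using y(1) complex_vector.span_mono[of "fst ` set es"] by auto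
  qed (auto intro: complex_vector.span_base simp: e_def)
  ultimately show ?case by blast
qed (auto intro: complex_vector.span_zero)

text \<open>
  Let \<open>v\<close> be in \<open>V\<close> but not in the span \<open>E\<close> of the chain. The last vector of the sequence
  \<open>(A - l)\<^sup>j v\<close> that is not in \<open>E\<close> is mapped into \<open>E\<close> by \<open>A - l\<close>; its normalized component orthogonal
  to \<open>E\<close> extends the chain.
\<close>
lemma schur_chain_extend:
  assumes chain: "schur_chain A es"
    and inv: "\<And>x. x \<in> V \<Longrightarrow> A x - l *\<^sub>C x \<in> V"
    and nil: "\<And>x. x \<in> V \<Longrightarrow> \<exists>k. ((\<lambda>x. A x - l *\<^sub>C x) ^^ k) x = 0"
    and V: "\<not> V \<subseteq> chain_span es"
  shows "\<exists>e. schur_chain A ((e, l) # es)"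
proof -
  define N where "N x = A x - l *\<^sub>C x" for x
  interpret N: complex_linear_map N unfolding N_def by (rule complex_linear_shift)
  obtain v where v: "v \<in> V" "v \<notin> chain_span es" using V by blast
  have ex: "\<exists>k. (N ^^ k) v \<in> chain_span es"
    using nil[OF v(1)] complex_vector.span_zero unfolding N_def[abs_def] by metis
  define k where "k = (LEAST k. (N ^^ k) v \<in> chain_span es)"
  have k: "(N ^^ k) v \<in> chain_span es" unfolding k_def using ex by (rule LeastI_ex)
  with v(2) obtain j where j: "k = Suc j" by (cases k) auto
  define u where "u = (N ^^ j) v"
  have u: "u \<notin> chain_span es"
    unfolding u_def using not_less_Least[of j "\<lambda>k. (N ^^ k) v \<in> chain_span es"]
    by (simp add: j flip: k_def)
  have Nu: "N u \<in> chain_span es" using k by (simp add: j u_def)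
  obtain y where y: "y \<in> chain_span es" "\<forall>f \<in> fst ` set es. cinner (u - y) f = 0"
    using schur_chain_projection[OF chain] by blast
  define w where "w = u - y"
  have "w \<noteq> 0" using u y by (auto simp: w_def)
  define e where "e = complex_of_real (1 / norm w) *\<^sub>C w"
  have "norm e = 1" using \<open>w \<noteq> 0\<close> by (simp add: e_def norm_scaleC norm_divide)
  moreover have "\<forall>f \<in> fst ` set es. cinner e f = 0"
    using y(2) by (simp add: e_def w_def cinner_scaleC_left)
  moreover have "N e \<in> chain_span es"
  proof -
    have "N w = N u - N y" using N.map_add[of w y] by (simp add: w_def)
    also have "\<dots> \<in> chain_span es"
      using Nu schur_chain_shift_invariant[OF chain y(1), of l]
      by (intro complex_vector.span_diff) (simp_all add: N_def)
    finally show ?thesis unfolding e_def N.map_scale by (rule complex_vector.span_scale)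
  qed
  ultimately show ?thesis using chain by (auto simp: N_def)
qed

lemma schur_chain_union_independent:
  assumes "schur_chain A es" "complex_vector.independent B"
    and "\<And>x. x \<in> chain_span es \<Longrightarrow> x \<in> complex_vector.span B \<Longrightarrow> x = 0"
  shows "complex_vector.independent (fst ` set es \<union> B) \<and> card (fst ` set es) = length es"
  using assms
proof (induction es)
  case (Cons q es)
  define e S where "e = fst q" "S = fst ` set es"
  have mono: "complex_vector.span S \<subseteq> chain_span (q # es)"
    unfolding e_S_def by (rule complex_vector.span_mono) auto
  have IH: "complex_vector.independent (S \<union> B) \<and> card S = length es"
    unfolding e_S_def using Cons.prems mono by (intro Cons.IH) (auto simp: e_S_def)
  have e: "norm e = 1" "\<And>f. f \<in> S \<Longrightarrow> cinner e f = 0"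
    using Cons.prems by (auto simp: e_S_def)
  have eS: "e \<notin> complex_vector.span S"
  proof
    assume "e \<in> complex_vector.span S"
    from orthogonal_to_span[OF e(2) this] e(1) show False by (simp add: cinner_self)
  qed
  have "e \<notin> complex_vector.span (S \<union> B)"
  proof
    assume "e \<in> complex_vector.span (S \<union> B)"
    then obtain s b where sb: "e = s + b" "s \<in> complex_vector.span S" "b \<in> complex_vector.span B"
      by (auto simp: complex_vector.span_Un)
    have "e \<in> chain_span (q # es)" by (rule complex_vector.span_base) (simp add: e_S_def)
    then have "e - s \<in> chain_span (q # es)"
      using mono sb(2) by (intro complex_vector.span_diff) auto
    then have "b = 0" using Cons.prems(3)[of b] sb by simp
    with sb eS show False by simp
  qed
  then have "complex_vector.independent (insert e (S \<union> B))"
    using IH by (intro complex_vector.independent_insertI) auto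
  moreover have "e \<notin> S" using eS complex_vector.span_base by blast
  ultimately show ?case using IH by (simp add: e_S_def)
qed simp

text \<open>
  As long as fewer than \<open>card B\<close> vectors have been added, the span of the chain is too small to contain
  \<open>V\<close>, since \<open>V\<close> meets the span of the original chain only in 0. Here \<open>V\<close> is the algebraic eigenspace
  for \<open>l\<close>, or a subspace of it.
\<close>
lemma schur_chain_append_eigenspace:
  assumes chain: "schur_chain A es" and l: "l \<notin> snd ` set es"
    and V: "complex_vector.subspace V"
    and inv: "\<And>x. x \<in> V \<Longrightarrow> A x - l *\<^sub>C x \<in> V"
    and nil: "\<And>x. x \<in> V \<Longrightarrow> \<exists>k. ((\<lambda>x. A x - l *\<^sub>C x) ^^ k) x = 0"
    and B: "complex_vector.independent B" "finite B" "B \<subseteq> V" and n: "n \<le> card B"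
  shows "\<exists>new. length new = n \<and> schur_chain A (new @ es) \<and> snd ` set new \<subseteq> {l}"
proof -
  have trivial: "x = 0" if x: "x \<in> chain_span es" "x \<in> V" for x
  proof -
    obtain k where "((\<lambda>x. A x - l *\<^sub>C x) ^^ k) x = 0" using nil[OF x(2)] by blast
    then show ?thesis using x(1)
    proof (induction k arbitrary: x)
      case (Suc k)
      from Suc.prems(1) have "((\<lambda>x. A x - l *\<^sub>C x) ^^ k) (A x - l *\<^sub>C x) = 0"
        by (simp only: funpow_Suc_right comp_apply)
      then have "A x - l *\<^sub>C x = 0"
        by (rule Suc.IH[OF _ schur_chain_shift_invariant[OF chain Suc.prems(2)]])
      then show ?case using schur_chain_eigenvector[OF chain l] Suc.prems(2) by simp
    qed simp
  qed
  have "complex_vector.span B \<subseteq> V"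
    using B(3) V by (rule complex_vector.span_minimal)
  with trivial have ind: "complex_vector.independent (fst ` set es \<union> B)"
    "card (fst ` set es) = length es"
    using schur_chain_union_independent[OF chain B(1)] by (simp_all add: subset_iff)
  have "0 \<notin> B" using B(1) complex_vector.dependent_zero by blast
  have no_common: False if x: "x \<in> fst ` set es" and "x \<in> B" for x
  proof -
    have "x = 0" using B(3) \<open>x \<in> B\<close> by (intro trivial complex_vector.span_base[OF x]) auto
    with \<open>x \<in> B\<close> \<open>0 \<notin> B\<close> show False by simp
  qed
  have disj: "fst ` set es \<inter> B = {}"
    by (rule equals0I, elim IntE, rule no_common)
  show ?thesis using n
  proof (induction n)
    case (Suc n)
    from Suc.IH[OF Suc_leD[OF Suc.prems]] obtain new
      where new: "length new = n" "schur_chain A (new @ es)" "snd ` set new \<subseteq> {l}"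
      by (elim exE conjE)
    have "\<not> V \<subseteq> chain_span (new @ es)"
    proof
      assume "V \<subseteq> chain_span (new @ es)"
      then have "B \<subseteq> chain_span (new @ es)" using B(3) by blast
      moreover have "fst ` set es \<subseteq> chain_span (new @ es)"
        by (rule order_trans[OF _ complex_vector.span_superset]) auto
      ultimately have "card (fst ` set es \<union> B) \<le> card (fst ` set (new @ es))"
        using complex_vector.independent_span_bound[OF _ ind(1)] by simp
      also have "\<dots> \<le> card (set (new @ es))" by (rule card_image_le) simp
      also have "\<dots> \<le> n + length es" using card_length[of "new @ es"] new(1) by simp
      finally have "card (fst ` set es \<union> B) \<le> n + length es" .
      moreover have "card (fst ` set es \<union> B) = length es + card B"
        using card_Un_disjoint[OF _ B(2) disj] ind(2) by simp
      ultimately show False using Suc.prems by simp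
    qed
    from schur_chain_extend[OF new(2) inv nil this] obtain e
      where "schur_chain A ((e, l) # new @ es)" by blast
    then show ?case using new by (intro exI[of _ "(e, l) # new"]) auto
  qed (use chain in auto)
qed

text \<open>
  The chain is built up one eigenvalue at a time. Sums of an arbitrary \<open>g\<close> over the diagonal encode
  that each \<open>l\<close> occurs there exactly as often as \<open>B l\<close> has elements.
\<close>
lemma ex_schur_chain:
  assumes "finite F"
    and V: "\<And>l. l \<in> F \<Longrightarrow> complex_vector.subspace (V l)"
    and inv: "\<And>l x. l \<in> F \<Longrightarrow> x \<in> V l \<Longrightarrow> A x - l *\<^sub>C x \<in> V l"
    and nil: "\<And>l x. l \<in> F \<Longrightarrow> x \<in> V l \<Longrightarrow> \<exists>k. ((\<lambda>x. A x - l *\<^sub>C x) ^^ k) x = 0"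
    and B: "\<And>l. l \<in> F \<Longrightarrow> complex_vector.independent (B l) \<and> finite (B l) \<and> B l \<subseteq> V l"
  shows "\<exists>es. schur_chain A es \<and> snd ` set es \<subseteq> F \<and>
    (\<forall>g :: complex \<Rightarrow> real. (\<Sum>q\<leftarrow>es. g (snd q)) = (\<Sum>l\<in>F. real (card (B l)) * g l))"
  using assms
proof (induction F rule: finite_induct)
  case empty
  show ?case by (intro exI[of _ "[]"]) simp
next
  case (insert l F)
  have "\<exists>es. schur_chain A es \<and> snd ` set es \<subseteq> F \<and>
      (\<forall>g :: complex \<Rightarrow> real. (\<Sum>q\<leftarrow>es. g (snd q)) = (\<Sum>l\<in>F. real (card (B l)) * g l))"
    by (rule insert.IH; use insert.prems in simp)
  then obtain es where es: "schur_chain A es" "snd ` set es \<subseteq> F"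
    "\<And>g :: complex \<Rightarrow> real. (\<Sum>q\<leftarrow>es. g (snd q)) = (\<Sum>l\<in>F. real (card (B l)) * g l)"
    by (elim exE conjE) simp
  have "l \<notin> snd ` set es" using es insert by auto
  then obtain new where new: "length new = card (B l)" "schur_chain A (new @ es)" "snd ` set new \<subseteq> {l}"
    using schur_chain_append_eigenspace[OF es(1), of l "V l" "B l" "card (B l)"] insert.prems by auto
  have "(\<Sum>q\<leftarrow>new. g (snd q)) = real (card (B l)) * g l" for g :: "complex \<Rightarrow> real"
  proof -
    have "map (\<lambda>q. g (snd q)) new = map (\<lambda>q. g l) new" using new(3) by (auto intro!: map_cong)
    then show ?thesis using new(1) by (simp add: sum_list_replicate map_replicate_const)
  qed
  then show ?case
    using es new insert.hyps by (intro exI[of _ "new @ es"]) auto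
qed

end

section \<open>The eigenvalue estimate\<close>

text \<open>
  An eigenvector of \<open>A\<close> in the range of \<open>P\<close> is fixed by \<open>P\<close>, but annihilated by \<open>P\<close> if its eigenvalue is
  not \<open>l\<close>. So \<open>A - l\<close> has no nonzero eigenvalue on the range, and it is nilpotent there.
\<close>
lemma discrete_eigenspace:
  assumes A: "A \<in> bounded_operators" and l: "l \<in> discrete_spectrum A"
  defines "V \<equiv> range (blinfun_apply (riesz_projection A l))"
  shows "complex_vector.subspace V"
    and "x \<in> V \<Longrightarrow> A x - l *\<^sub>C x \<in> V"
    and "x \<in> V \<Longrightarrow> \<exists>k. ((\<lambda>x. A x - l *\<^sub>C x) ^^ k) x = 0"
    and "\<exists>B. complex_vector.independent B \<and> finite B \<and> B \<subseteq> V \<and> card B = alg_multiplicity A l"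
proof -
  define P where "P = riesz_projection A l"
  have iso: "l isolated_in spectrum A" and "finite_rank P"
    using l by (auto simp: discrete_spectrum_def P_def)
  then obtain S where S: "finite S" "V \<subseteq> complex_vector.span S"
    by (auto simp: finite_rank_def V_def P_def)
  note PB = riesz_projection_bounded_operators[OF A iso, folded P_def]
  show sub: "complex_vector.subspace V"
    unfolding complex_vector.subspace_def V_def P_def[symmetric]
    by (auto simp: image_iff simp flip: blinfun.add_right bounded_operators_scaleC[OF PB])
      (metis blinfun.zero_right)
  have PV: "P x = x" if "x \<in> V" for x
    using that riesz_projection_idem[OF A iso] by (auto simp: V_def P_def)
  have AV: "A x \<in> V" if "x \<in> V" for x
    using that riesz_projection_commute[OF A iso] by (auto simp: V_def)
  show inv: "A x - l *\<^sub>C x \<in> V" if "x \<in> V" for x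
    using that AV sub by (intro complex_vector.subspace_diff complex_vector.subspace_scale)
  interpret N: complex_linear_map "\<lambda>x. A x - l *\<^sub>C x"
    by (rule complex_linear_shift[OF A])
  show "\<exists>k. ((\<lambda>x. A x - l *\<^sub>C x) ^^ k) x = 0" if "x \<in> V" for x
  proof (rule N.nilpotent_if_no_nonzero_eigenvalue[OF sub S inv _ that])
    fix x c assume x: "x \<in> V" "c \<noteq> 0" "A x - l *\<^sub>C x = c *\<^sub>C x"
    then have "A x = (l + c) *\<^sub>C x" by (simp add: scaleC_add_left algebra_simps)
    then have "P x = 0"
      unfolding P_def using x(2) by (intro riesz_projection_other_eigenvector[OF A iso]) auto
    then show "x = 0" using PV[OF x(1)] by simp
  qed
  obtain B where B: "B \<subseteq> V" "complex_vector.independent B" "card B = complex_vector.dim V"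
    using complex_vector.basis_exists[of V] by metis
  moreover have "finite B"
    using complex_vector.independent_span_bound[OF S(1) B(2)] B(1) S(2) by blast
  ultimately show "\<exists>B. complex_vector.independent B \<and> finite B \<and> B \<subseteq> V \<and> card B = alg_multiplicity A l"
    by (auto simp: alg_multiplicity_def op_rank_def V_def)
qed

lemma finite_eigenvalue_sum_le:
  fixes Z\<^sub>0 Z :: "'h :: complex_hilbert \<Rightarrow>\<^sub>L 'h"
  assumes Z0: "Z\<^sub>0 \<in> bounded_operators" and Z: "Z \<in> bounded_operators"
    and p: "1 \<le> p" and K: "Z - Z\<^sub>0 \<in> schatten_class p"
    and normal: "normal_op Z\<^sub>0" and conv: "convex (spectrum Z\<^sub>0)" and ne: "spectrum Z\<^sub>0 \<noteq> {}"
    and F: "finite F" "F \<subseteq> discrete_spectrum Z"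
  shows "(\<Sum>l\<in>F. real (alg_multiplicity Z l) * infdist l (spectrum Z\<^sub>0) powr p)
    \<le> schatten_norm p (Z - Z\<^sub>0) powr p"
proof -
  define V where "V l = range (blinfun_apply (riesz_projection Z l))" for l
  define g where "g l = infdist l (spectrum Z\<^sub>0) powr p" for l
  have eig: "l \<in> discrete_spectrum Z" if "l \<in> F" for l using that F by blast
  note V = discrete_eigenspace[OF Z eig, folded V_def]
  from V(4) obtain B where B: "\<And>l. l \<in> F \<Longrightarrow> complex_vector.independent (B l) \<and> finite (B l)
      \<and> B l \<subseteq> V l \<and> card (B l) = alg_multiplicity Z l"
    by metis
  have "\<exists>es. schur_chain Z es \<and> snd ` set es \<subseteq> F \<and>
    (\<forall>g :: complex \<Rightarrow> real. (\<Sum>q\<leftarrow>es. g (snd q)) = (\<Sum>l\<in>F. real (card (B l)) * g l))"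
    by (rule ex_schur_chain[OF Z F(1), of V]) (use V(1-3) B in auto)
  then obtain es where es: "schur_chain Z es"
    and sum: "(\<Sum>q\<leftarrow>es. g (snd q)) = (\<Sum>l\<in>F. real (card (B l)) * g l)"
    by blast
  note facts = schur_chain_facts[OF Z es]
  have "(\<Sum>l\<in>F. real (alg_multiplicity Z l) * g l) = (\<Sum>q\<in>set es. g (snd q))"
    using B by (simp add: sum.distinct_set_conv_list[OF facts(4)] sum)
  also have "\<dots> \<le> (\<Sum>q\<in>set es. cmod (cinner ((Z - Z\<^sub>0) (fst q)) (fst q)) powr p)"
  proof (rule sum_mono)
    fix q assume q: "q \<in> set es"
    have "cinner (Z\<^sub>0 (fst q)) (fst q) \<in> spectrum Z\<^sub>0"
      by (rule numerical_value_in_convex_spectrum[OF Z0 normal conv ne facts(1)[OF q]])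
    then have "infdist (snd q) (spectrum Z\<^sub>0) \<le> dist (snd q) (cinner (Z\<^sub>0 (fst q)) (fst q))"
      by (rule infdist_le)
    also have "\<dots> = cmod (cinner ((Z - Z\<^sub>0) (fst q)) (fst q))"
      by (simp add: dist_norm blinfun.diff_left cinner.diff_left facts(2)[OF q])
    finally show "g (snd q) \<le> cmod (cinner ((Z - Z\<^sub>0) (fst q)) (fst q)) powr p"
      unfolding g_def using p by (intro powr_mono2) (auto simp: infdist_nonneg)
  qed
  also have "\<dots> \<le> schatten_norm p (Z - Z\<^sub>0) powr p"
    by (rule sum_diagonal_powr_le[OF K p]) (use facts(1,3) in auto)
  finally show ?thesis by (simp add: g_def)
qed

theorem corollary5p2p3:
  fixes Z\<^sub>0 Z :: "'h :: complex_hilbert \<Rightarrow>\<^sub>L 'h" and p :: real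
  assumes "separable_space (euclidean :: 'h topology)"
    and "Z\<^sub>0 \<in> bounded_operators" and "Z \<in> bounded_operators"
    and "p \<ge> 1" and "Z - Z\<^sub>0 \<in> schatten_class p"
    and "normal_op Z\<^sub>0" and "convex (spectrum Z\<^sub>0)"
  shows "(\<lambda>l. real (alg_multiplicity Z l) * infdist l (spectrum Z\<^sub>0) powr p)
           summable_on discrete_spectrum Z
       \<and> (\<Sum>\<^sub>\<infinity>l\<in>discrete_spectrum Z.
            real (alg_multiplicity Z l) * infdist l (spectrum Z\<^sub>0) powr p)
         \<le> schatten_norm p (Z - Z\<^sub>0) powr p"
proof -
  define h where "h l = real (alg_multiplicity Z l) * infdist l (spectrum Z\<^sub>0) powr p" for l
  have fin: "sum h F \<le> schatten_norm p (Z - Z\<^sub>0) powr p"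
    if "finite F" "F \<subseteq> discrete_spectrum Z" for F
  proof (cases "spectrum Z\<^sub>0 = {}")
    case True
    \<comment> \<open>The distance from the empty set is 0 by convention.\<close>
    then have "sum h F = 0" by (simp add: h_def infdist_def)
    then show ?thesis by simp
  next
    case False
    then show ?thesis
      unfolding h_def
      by (intro finite_eigenvalue_sum_le[OF assms(2-7) _ that])
  qed
  have "h summable_on discrete_spectrum Z"
  proof (rule nonneg_bdd_above_summable_on)
    show "bdd_above (sum h ` {F. F \<subseteq> discrete_spectrum Z \<and> finite F})"
      using fin by (intro bdd_aboveI2) auto
  qed (simp add: h_def)
  moreover from this fin have "infsum h (discrete_spectrum Z) \<le> schatten_norm p (Z - Z\<^sub>0) powr p"
    by (rule infsum_le_finite_sums)
  ultimately show ?thesis unfolding h_def[abs_def] by simp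
qed

end
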